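(* Let $\chi$ be a probability distribution on $\mathbb{N}_0$ with $0<\chi(0)<1$. For any fixed $k\in\mathbb{N}$, if $n\ell_k=c_k$ and $\max\{H_k'(c_k),|F_k'(c_k)|\}<1$, then the expected duration (number of rounds, under optimal play) of the $k$-jump normal game started at the root of the Galton-Watson tree $\mathcal{T}_\chi$ is finite. Moreover, for $k=2,3$, if $n\ell_k=c_k$ and $|F_k'(c_k)|<1$, then the expected duration of the $k$-jump normal game is finite.
   Context: $\mathbb{N}=\{1,2,\dots\}$, $\mathbb{N}_0=\mathbb{N}\cup\{0\}$. $G(x)=\sum_{m\ge 0}\chi(m)x^m$ on $[0,1]$. Game. $\mathcal{T}_\chi$ is the rooted Galton-Watson tree in which every vertex independently has a number of children distributed as $\chi$. For a vertex $u$, $\Gamma_k(u)$ is the set of descendants $v\neq u$ of $u$ at graph distance at most $k$ from $u$. In the $k$-jump normal game a token starts at a vertex; two players P1, P2 alternate (P1 first), and a move (one round) relocates the token from its current vertex $u$ to any vertex of $\Gamma_k(u)$. A player unable to move loses. The tree is fully known to both players. Optimal play means: if one of the players has a winning strategy, she tries to win in as few rounds as possible, while her opponent tries to prolong the game as much as possible. A game in which neither player has a winning strategy is a draw (it goes on forever). $n\ell_k$ is the probability that P1 loses the game started at the root. The duration $T$ satisfies: for $n\in\mathbb{N}$, $T<n$ iff one of the players has a strategy guaranteeing that she wins within fewer than $n$ rounds. Functions $F_i$ and numbers $c_i$. $F_0(x)=1$ on $[0,1]$, $c_0=1$, and recursively for $i\in\mathbb{N}$, $F_i:[0,c_{i-1}]\to[0,1]$,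 $F_i(x)=G(F_{i-1}(x)-x)$, where $c_i$ is the unique fixed point of $F_i$ (it is known that $c_i$ exists, is unique, and $c_i<c_{i-1}$). Functions $g_i$ and $H_k$. $g_1(x,y)=x-y$ on $\mathbb{R}^2$, and for $i\ge2$, $g_i(x_0,x_1,\ldots,x_i)=G(g_{i-1}(x_0,x_2,\ldots,x_i))-G(g_{i-1}(x_1,x_2,\ldots,x_i))$, defined where the two arguments of $G$ are defined and lie in $[0,1]$. $H_k:[0,c_{k-1}]\to[0,1]$ is $H_k(x)=G\big(g_k(F_0(x),F_1(x),\ldots,F_k(x))\big)$. *)

theory Defs
  imports "HOL-Probability.Probability"
begin

section \<open>Galton-Watson trees\<close>

text \<open>
  Vertices carry Ulam-Harris labels: the root is \<open>[]\<close> and the \<open>i\<close>-th child of \<open>u\<close>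
  is \<open>u @ [i]\<close>. A tree is determined by the number \<open>\<omega> u\<close> of children of every label \<open>u\<close>;
  the values of \<open>\<omega>\<close> at labels that are not vertices are irrelevant.
\<close>

type_synonym vertex = "nat list"

inductive_set tree_of :: "(vertex \<Rightarrow> nat) \<Rightarrow> vertex set" for \<omega> :: "vertex \<Rightarrow> nat" where
  root: "[] \<in> tree_of \<omega>"
| child: "u \<in> tree_of \<omega> \<Longrightarrow> i < \<omega> u \<Longrightarrow> u @ [i] \<in> tree_of \<omega>"

definition GW :: "nat pmf \<Rightarrow> (vertex \<Rightarrow> nat) measure" where
  "GW \<mu> = (\<Pi>\<^sub>M u\<in>UNIV. measure_pmf \<mu>)"

definition Gamma :: "vertex set \<Rightarrow> nat \<Rightarrow> vertex \<Rightarrow> vertex set" where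
  "Gamma t k u = {u @ w | w. w \<noteq> [] \<and> length w \<le> k \<and> u @ w \<in> t}"


section \<open>The k-jump normal game\<close>

datatype player = P1 | P2

text \<open>The player who moves after \<open>m\<close> rounds have been played.\<close>

definition to_move :: "nat \<Rightarrow> player" where
  "to_move m = (if even m then P1 else P2)"

text \<open>
  A history is the nonempty list of the positions visited so far, in chronological order.
  It is a completed play if no move is possible from its last position.
\<close>

definition history :: "vertex set \<Rightarrow> nat \<Rightarrow> vertex \<Rightarrow> vertex list \<Rightarrow> bool" where
  "history t k r h \<longleftrightarrow>
     h \<noteq> [] \<and> hd h = r \<and> (\<forall>i. Suc i < length h \<longrightarrow> h ! Suc i \<in> Gamma t k (h ! i))"

definition rounds :: "vertex list \<Rightarrow> nat" where
  "rounds h = length h - 1"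

definition finite_play :: "vertex set \<Rightarrow> nat \<Rightarrow> vertex \<Rightarrow> vertex list \<Rightarrow> bool" where
  "finite_play t k r h \<longleftrightarrow> history t k r h \<and> Gamma t k (last h) = {}"

definition infinite_play :: "vertex set \<Rightarrow> nat \<Rightarrow> vertex \<Rightarrow> (nat \<Rightarrow> vertex) \<Rightarrow> bool" where
  "infinite_play t k r f \<longleftrightarrow> f 0 = r \<and> (\<forall>i. f (Suc i) \<in> Gamma t k (f i))"

text \<open>
  Strategies may depend on the whole history. They have to prescribe a legal move
  whenever there is one; their values elsewhere are irrelevant.
\<close>

type_synonym strategy = "vertex list \<Rightarrow> vertex"

definition is_strategy ::
    "vertex set \<Rightarrow> nat \<Rightarrow> vertex \<Rightarrow> player \<Rightarrow> strategy \<Rightarrow> bool" where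
  "is_strategy t k r p \<sigma> \<longleftrightarrow>
     (\<forall>h. history t k r h \<and> to_move (rounds h) = p \<and> Gamma t k (last h) \<noteq> {}
        \<longrightarrow> \<sigma> h \<in> Gamma t k (last h))"

definition follows :: "player \<Rightarrow> strategy \<Rightarrow> vertex list \<Rightarrow> bool" where
  "follows p \<sigma> h \<longleftrightarrow>
     (\<forall>i. Suc i < length h \<and> to_move i = p \<longrightarrow> h ! Suc i = \<sigma> (take (Suc i) h))"

definition winning_strategy ::
    "vertex set \<Rightarrow> nat \<Rightarrow> vertex \<Rightarrow> player \<Rightarrow> strategy \<Rightarrow> bool" where
  "winning_strategy t k r p \<sigma> \<longleftrightarrow>
     is_strategy t k r p \<sigma> \<and>
     (\<forall>h. finite_play t k r h \<and> follows p \<sigma> h \<longrightarrow> to_move (rounds h) \<noteq> p) \<and>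
     \<not> (\<exists>f. infinite_play t k r f \<and> (\<forall>n. follows p \<sigma> (map f [0..<n])))"

definition wins_in_fewer ::
    "vertex set \<Rightarrow> nat \<Rightarrow> vertex \<Rightarrow> player \<Rightarrow> strategy \<Rightarrow> nat \<Rightarrow> bool" where
  "wins_in_fewer t k r p \<sigma> n \<longleftrightarrow>
     winning_strategy t k r p \<sigma> \<and>
     (\<forall>h. finite_play t k r h \<and> follows p \<sigma> h \<longrightarrow> rounds h < n)"

text \<open>The duration under optimal play; it is \<open>\<infinity>\<close> for a draw.\<close>

definition duration :: "vertex set \<Rightarrow> nat \<Rightarrow> vertex \<Rightarrow> enat" where
  "duration t k r = Inf {enat m | m. \<exists>p \<sigma>. wins_in_fewer t k r p \<sigma> (Suc m)}"

lemma duration_less_iff: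
  assumes "0 < n"
  shows "duration t k r < enat n \<longleftrightarrow> (\<exists>p \<sigma>. wins_in_fewer t k r p \<sigma> n)"
proof
  assume "duration t k r < enat n"
  then obtain m p \<sigma> where "m < n" and w: "wins_in_fewer t k r p \<sigma> (Suc m)"
    unfolding duration_def Inf_less_iff by auto
  then have "wins_in_fewer t k r p \<sigma> n"
    unfolding wins_in_fewer_def by fastforce
  then show "\<exists>p \<sigma>. wins_in_fewer t k r p \<sigma> n" by blast
next
  assume "\<exists>p \<sigma>. wins_in_fewer t k r p \<sigma> n"
  moreover obtain m where "n = Suc m"
    using assms by (cases n) auto
  ultimately show "duration t k r < enat n"
    unfolding duration_def Inf_less_iff by (intro bexI[of _ "enat m"]) auto
qed

definition nl :: "nat pmf \<Rightarrow> nat \<Rightarrow> real" where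
  "nl \<mu> k = \<P>(\<omega> in GW \<mu>. \<exists>\<sigma>. winning_strategy (tree_of \<omega>) k [] P2 \<sigma>)"

definition expected_duration :: "nat pmf \<Rightarrow> nat \<Rightarrow> ennreal" where
  "expected_duration \<mu> k = (\<integral>\<^sup>+ \<omega>. ennreal_of_enat (duration (tree_of \<omega>) k []) \<partial>GW \<mu>)"


section \<open>The functions and their fixed points\<close>

text \<open>
  All functions below are total. Their values are meaningful on the following domains:
  \<open>G \<mu>\<close> on \<open>[0, 1]\<close>, \<open>F \<mu> 0\<close> on \<open>[0, 1]\<close>, and \<open>F \<mu> i\<close> and \<open>H \<mu> i\<close> on
  \<open>[0, fp \<mu> (i - 1)]\<close> for \<open>i \<ge> 1\<close>. If \<open>0 < pmf \<mu> 0 < 1\<close> then \<open>fp \<mu> i\<close> is an interior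
  point of \<open>[0, fp \<mu> (i - 1)]\<close>, so derivatives there do not depend on values outside
  the domains.
\<close>

definition G :: "nat pmf \<Rightarrow> real \<Rightarrow> real" where
  "G \<mu> x = (\<Sum>m. pmf \<mu> m * x ^ m)"

primrec F :: "nat pmf \<Rightarrow> nat \<Rightarrow> real \<Rightarrow> real" where
  "F \<mu> 0 x = 1"
| "F \<mu> (Suc i) x = G \<mu> (F \<mu> i x - x)"

primrec fp :: "nat pmf \<Rightarrow> nat \<Rightarrow> real" where
  "fp \<mu> 0 = 1"
| "fp \<mu> (Suc i) = (THE x. x \<in> {0..fp \<mu> i} \<and> F \<mu> (Suc i) x = x)"

text \<open>The function of \<open>i + 1\<close> real variables with index \<open>i \<ge> 1\<close> acts on lists of length
  \<open>i + 1\<close>; it is unspecified on lists with fewer than two entries.\<close>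

fun g :: "nat pmf \<Rightarrow> real list \<Rightarrow> real" where
  "g \<mu> [x, y] = x - y"
| "g \<mu> (x0 # x1 # x2 # xs) = G \<mu> (g \<mu> (x0 # x2 # xs)) - G \<mu> (g \<mu> (x1 # x2 # xs))"

definition H :: "nat pmf \<Rightarrow> nat \<Rightarrow> real \<Rightarrow> real" where
  "H \<mu> k x = G \<mu> (g \<mu> (map (\<lambda>i. F \<mu> i x) [0..<Suc k]))"

end

theory Submission
  imports Defs
begin

text \<open>
  Write \<open>x n\<close> for the probability that the first player loses within fewer than \<open>n\<close> rounds, and
  \<open>y n\<close> for the probability that she wins within fewer than \<open>n\<close> rounds. The expected duration is at
  most the sum of the probabilities \<open>1 - x n - y n\<close> that the game is not decided so quickly, so
  everything rests on how fast these tend to \<open>0\<close>.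

  The functions of the statement describe \<open>x\<close> and \<open>y\<close> exactly. Splitting the tree at its root
  gives \<open>y (n + 1) = 1 - F k (x n)\<close> (\<open>prob_mover_wins_step\<close>) and \<open>x (n + 2) = H k (x n)\<close>
  (\<open>prob_mover_loses_step\<close>). The probabilities can be subtracted as in the definitions of \<open>F k\<close>
  and \<open>H k\<close> because a position lost within fewer than \<open>n\<close> rounds has no other such position among
  its options. Moreover \<open>x n\<close> increases to \<open>nl\<close>, because
  by local finiteness a forced win is forced within a bounded number of rounds.

  Now let \<open>nl = c\<close> with \<open>c = fp k\<close>. This \<open>c\<close> is a fixed point of \<open>F k\<close>, and also of \<open>H k\<close>. At \<open>c\<close> all
  values at which \<open>G\<close> is evaluated lie strictly between \<open>0\<close> and \<open>1\<close>, so that \<open>F k\<close> and \<open>H k\<close> are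
  differentiable there. If \<open>H k\<close> has derivative less than \<open>1\<close> at \<open>c\<close>, then \<open>c - x (n + 2)\<close> is eventually at most
  \<open>\<rho> * (c - x n)\<close> with a constant \<open>\<rho> < 1\<close>, so \<open>c - x n\<close> is summable. As \<open>F k\<close> is differentiable at
  its fixed point \<open>c\<close>, the quantity \<open>1 - x (n + 1) - y (n + 1) = F k (x n) - x (n + 1)\<close> is summable too
  (\<open>finite_expected_duration\<close>).

  For \<open>k = 2\<close> and \<open>k = 3\<close> the chain rule expresses the derivative of \<open>H k\<close> at \<open>c\<close> as the square of
  the derivative of \<open>F k\<close> minus a nonnegative quantity (\<open>deriv_H_less_1_k2\<close>, \<open>deriv_H_less_1_k3\<close>), so a
  bound on the derivative of \<open>F k\<close> suffices.
\<close>

section \<open>Subtrees and descendants\<close>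

definition subtree :: "vertex \<Rightarrow> (vertex \<Rightarrow> nat) \<Rightarrow> vertex \<Rightarrow> nat" where
  "subtree u \<omega> = (\<lambda>w. \<omega> (u @ w))"

lemma subtree_Nil [simp]: "subtree [] \<omega> = \<omega>"
  by (simp add: subtree_def)

lemma subtree_subtree [simp]: "subtree w (subtree u \<omega>) = subtree (u @ w) \<omega>"
  by (simp add: subtree_def)

lemma snoc_mem_tree_of: "u @ [i] \<in> tree_of \<omega> \<longleftrightarrow> u \<in> tree_of \<omega> \<and> i < \<omega> u"
  by (subst tree_of.simps) auto

lemma append_mem_tree_of:
  "u @ w \<in> tree_of \<omega> \<longleftrightarrow> u \<in> tree_of \<omega> \<and> w \<in> tree_of (subtree u \<omega>)"
proof (induction w rule: rev_induct)
  case Nil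
  show ?case by (simp add: tree_of.root)
next
  case (snoc i w)
  have "u @ w @ [i] \<in> tree_of \<omega> \<longleftrightarrow> u @ w \<in> tree_of \<omega> \<and> i < \<omega> (u @ w)"
    using snoc_mem_tree_of[of "u @ w"] by simp
  with snoc show ?case by (auto simp: snoc_mem_tree_of subtree_def)
qed

lemma Cons_mem_tree_of: "i # w \<in> tree_of \<omega> \<longleftrightarrow> i < \<omega> [] \<and> w \<in> tree_of (subtree [i] \<omega>)"
  using append_mem_tree_of[of "[i]" w \<omega>] snoc_mem_tree_of[of "[]" i \<omega>] by (simp add: tree_of.root)

text \<open>
  The depth bound is counted down along the children, so that a statement about the first \<open>j\<close>
  generations becomes a statement about the independent subtrees of the root's children.
\<close>

primrec all_desc :: "nat \<Rightarrow> ((vertex \<Rightarrow> nat) \<Rightarrow> bool) \<Rightarrow> (vertex \<Rightarrow> nat) \<Rightarrow> bool" where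
  "all_desc 0 Q \<omega> \<longleftrightarrow> True"
| "all_desc (Suc j) Q \<omega> \<longleftrightarrow>
     (\<forall>i<\<omega> []. Q (subtree [i] \<omega>) \<and> all_desc j Q (subtree [i] \<omega>))"

lemma all_desc_iff:
  "all_desc j Q \<omega> \<longleftrightarrow>
     (\<forall>w\<in>tree_of \<omega>. w \<noteq> [] \<and> length w \<le> j \<longrightarrow> Q (subtree w \<omega>))"
proof (induction j arbitrary: \<omega>)
  case 0
  show ?case by simp
next
  case (Suc j)
  have "all_desc (Suc j) Q \<omega> \<longleftrightarrow>
      (\<forall>i<\<omega> []. \<forall>w\<in>tree_of (subtree [i] \<omega>). length w \<le> j \<longrightarrow> Q (subtree (i # w) \<omega>))"
    unfolding all_desc.simps Suc.IH by (force simp: tree_of.root)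
  also have "\<dots> \<longleftrightarrow>
      (\<forall>w\<in>tree_of \<omega>. w \<noteq> [] \<and> length w \<le> Suc j \<longrightarrow> Q (subtree w \<omega>))"
    (is "?L \<longleftrightarrow> ?R")
  proof
    assume ?L
    show ?R
    proof (intro ballI impI)
      fix w assume "w \<in> tree_of \<omega>" "w \<noteq> [] \<and> length w \<le> Suc j"
      with \<open>?L\<close> show "Q (subtree w \<omega>)" by (cases w) (auto simp: Cons_mem_tree_of)
    qed
  qed (auto simp: Cons_mem_tree_of)
  finally show ?case .
qed

lemma all_desc_mono:
  assumes "all_desc j Q \<omega>" "i \<le> j" "\<And>\<omega>. Q \<omega> \<Longrightarrow> R \<omega>"
  shows "all_desc i R \<omega>"
  using assms unfolding all_desc_iff by auto

lemma all_desc_subtree_iff: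
  assumes "u \<in> tree_of \<omega>"
  shows "all_desc k Q (subtree u \<omega>) \<longleftrightarrow> (\<forall>v\<in>Gamma (tree_of \<omega>) k u. Q (subtree v \<omega>))"
  using assms by (auto simp: all_desc_iff Gamma_def append_mem_tree_of)

lemma Gamma_subset: "Gamma t k u \<subseteq> t"
  by (auto simp: Gamma_def)

lemma finite_Gamma: "finite (Gamma (tree_of \<omega>) k u)"
proof -
  have "finite {w \<in> tree_of \<omega>. length w \<le> j}" for j and \<omega> :: "vertex \<Rightarrow> nat"
  proof (induction j)
    case (Suc j)
    have "{w \<in> tree_of \<omega>. length w \<le> Suc j} \<subseteq>
      insert [] (\<Union>u\<in>{w \<in> tree_of \<omega>. length w \<le> j}. (\<lambda>i. u @ [i]) ` {..<\<omega> u})"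
    proof
      fix w assume w: "w \<in> {w \<in> tree_of \<omega>. length w \<le> Suc j}"
      show "w \<in> insert [] (\<Union>u\<in>{w \<in> tree_of \<omega>. length w \<le> j}. (\<lambda>i. u @ [i]) ` {..<\<omega> u})"
        using w by (cases w rule: rev_cases) (auto simp: snoc_mem_tree_of)
    qed
    then show ?case by (rule finite_subset) (use Suc in auto)
  qed simp
  moreover have "Gamma (tree_of \<omega>) k u \<subseteq> (@) u ` {w \<in> tree_of (subtree u \<omega>). length w \<le> k}"
    by (auto simp: Gamma_def append_mem_tree_of)
  ultimately show ?thesis by (meson finite_imageI finite_subset)
qed

section \<open>Positions decided within a bounded number of rounds\<close>

text \<open>
  The outcome for the player about to move at the root, when at most \<open>n - 1\<close> rounds are allowed.
  The bound enters by backward induction; at \<open>n = 0\<close> nobody has won yet.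
\<close>

fun mover_loses mover_wins :: "nat \<Rightarrow> nat \<Rightarrow> (vertex \<Rightarrow> nat) \<Rightarrow> bool" where
  "mover_loses k 0 \<omega> \<longleftrightarrow> False"
| "mover_loses k (Suc n) \<omega> \<longleftrightarrow> all_desc k (mover_wins k n) \<omega>"
| "mover_wins k 0 \<omega> \<longleftrightarrow> False"
| "mover_wins k (Suc n) \<omega> \<longleftrightarrow> \<not> all_desc k (\<lambda>\<omega>. \<not> mover_loses k n \<omega>) \<omega>"

lemmas mover_simps = mover_loses.simps(2) mover_wins.simps(2)

declare mover_simps [simp del]

lemma mover_mono_Suc:
  "(mover_loses k n \<omega> \<longrightarrow> mover_loses k (Suc n) \<omega>) \<and> (mover_wins k n \<omega> \<longrightarrow> mover_wins k (Suc n) \<omega>)"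
proof (induction n arbitrary: \<omega>)
  case (Suc n)
  have "mover_loses k (Suc (Suc n)) \<omega>" if "mover_loses k (Suc n) \<omega>"
    using that Suc.IH unfolding mover_simps(1)[of k "Suc n"] mover_simps(1)[of k n \<omega>]
    by (blast intro: all_desc_mono[OF _ order_refl])
  moreover have "mover_wins k (Suc (Suc n)) \<omega>" if "mover_wins k (Suc n) \<omega>"
  proof -
    have "all_desc k (\<lambda>\<omega>. \<not> mover_loses k n \<omega>) \<omega>"
      if "all_desc k (\<lambda>\<omega>. \<not> mover_loses k (Suc n) \<omega>) \<omega>"
      by (rule all_desc_mono[OF that order_refl]) (use Suc.IH in blast)
    with that show ?thesis by (auto simp: mover_simps(2)[of k _ \<omega>])
  qed
  ultimately show ?case by blast
qed simp

lemma mover_loses_mono: "m \<le> n \<Longrightarrow> mover_loses k m \<omega> \<Longrightarrow> mover_loses k n \<omega>"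
  by (induction n rule: dec_induct) (use mover_mono_Suc in blast)+

lemma mover_wins_mono: "m \<le> n \<Longrightarrow> mover_wins k m \<omega> \<Longrightarrow> mover_wins k n \<omega>"
  by (induction n rule: dec_induct) (use mover_mono_Suc in blast)+

lemma not_mover_loses_and_wins: "\<not> (mover_loses k n \<omega> \<and> mover_wins k n \<omega>)"
proof (induction n arbitrary: \<omega>)
  case (Suc n)
  show ?case
  proof
    assume "mover_loses k (Suc n) \<omega> \<and> mover_wins k (Suc n) \<omega>"
    then have "all_desc k (mover_wins k n) \<omega>" "\<not> all_desc k (\<lambda>\<omega>. \<not> mover_loses k n \<omega>) \<omega>"
      by (simp_all add: mover_simps)
    moreover have "all_desc k (\<lambda>\<omega>. \<not> mover_loses k n \<omega>) \<omega>"
      by (rule all_desc_mono[OF calculation(1) order_refl]) (use Suc.IH in blast)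
    ultimately show False by simp
  qed
qed simp

text \<open>
  Every move out of a lost position leads to a won one, which is not lost. This exclusion is what
  makes the generating function recursion for the probabilities close up.
\<close>

lemma mover_loses_imp_all_desc:
  assumes "mover_loses k n \<omega>"
  shows "all_desc k (\<lambda>\<omega>. \<not> mover_loses k n \<omega>) \<omega>"
proof -
  have "mover_loses k (Suc n) \<omega>" using assms mover_mono_Suc by blast
  then have "\<not> mover_wins k (Suc n) \<omega>" using not_mover_loses_and_wins by blast
  then show ?thesis by (simp add: mover_simps)
qed

lemma mover_loses_subtree_iff:
  assumes "u \<in> tree_of \<omega>"
  shows "mover_loses k (Suc n) (subtree u \<omega>) \<longleftrightarrow>
    (\<forall>v\<in>Gamma (tree_of \<omega>) k u. mover_wins k n (subtree v \<omega>))"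
  using all_desc_subtree_iff[OF assms] by (simp add: mover_simps)

lemma mover_wins_subtree_iff:
  assumes "u \<in> tree_of \<omega>"
  shows "mover_wins k (Suc n) (subtree u \<omega>) \<longleftrightarrow>
    (\<exists>v\<in>Gamma (tree_of \<omega>) k u. mover_loses k n (subtree v \<omega>))"
  using all_desc_subtree_iff[OF assms] by (simp add: mover_simps)

lemma history_mem:
  assumes "history t k r h" "r \<in> t" "i < length h"
  shows "h ! i \<in> t"
proof (cases i)
  case 0
  have "h \<noteq> []" "hd h = r" using assms(1) by (simp_all add: history_def)
  with 0 assms(2) show ?thesis by (simp add: hd_conv_nth)
next
  case (Suc j)
  then have "h ! i \<in> Gamma t k (h ! j)" using assms(1,3) by (simp add: history_def)
  then show ?thesis using Gamma_subset by blast
qed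

lemma to_move_cases: "to_move m = P1 \<or> to_move m = P2"
  by (auto simp: to_move_def)

lemma to_move_Suc: "to_move (Suc m) = p \<longleftrightarrow> to_move m \<noteq> p"
  by (cases p) (auto simp: to_move_def)

text \<open>
  The winner always moves to a position that is lost for the opponent with the smallest possible
  bound. Along a play of this strategy the bound drops by one in each round, and since bound \<open>0\<close>
  is impossible, the play stops in time.
\<close>

lemma labelled_imp_wins_in_fewer:
  fixes p n \<omega> k
  assumes start: "if p = P1 then mover_wins k n \<omega> else mover_loses k n \<omega>"
  shows "\<exists>\<sigma>. wins_in_fewer (tree_of \<omega>) k [] p \<sigma> n"
proof -
  define t where "t = tree_of \<omega>"
  define win where "win m u = mover_wins k m (subtree u \<omega>)" for m u
  define lose where "lose m u = mover_loses k m (subtree u \<omega>)" for m u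
  have lose_step: "win m v" if "u \<in> t" "lose (Suc m) u" "v \<in> Gamma t k u" for m u v
    using mover_loses_subtree_iff[of u \<omega> k m] that by (auto simp: t_def win_def lose_def)
  have ex: "\<exists>v. v \<in> Gamma t k u \<and> (\<forall>m. win (Suc m) u \<longrightarrow> lose m v)"
    if "u \<in> t" "Gamma t k u \<noteq> {}" for u
  proof (cases "\<exists>m. win (Suc m) u")
    case True
    define m where "m = (LEAST m. win (Suc m) u)"
    have "win (Suc m) u" unfolding m_def using True by (rule LeastI_ex)
    then have "\<exists>v\<in>Gamma t k u. lose m v"
      using mover_wins_subtree_iff[of u \<omega> k m] that by (simp add: t_def win_def lose_def)
    then obtain v where v: "v \<in> Gamma t k u" "lose m v" by blast
    have "lose m' v" if "win (Suc m') u" for m'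
      using Least_le[of "\<lambda>m. win (Suc m) u", OF that] v mover_loses_mono
      unfolding m_def[symmetric] lose_def by blast
    with v show ?thesis by blast
  next
    case False
    with that show ?thesis by blast
  qed
  define \<sigma> :: strategy where
    "\<sigma> h = (SOME v. v \<in> Gamma t k (last h) \<and> (\<forall>m. win (Suc m) (last h) \<longrightarrow> lose m v))" for h
  have \<sigma>: "\<sigma> h \<in> Gamma t k (last h)" "win (Suc m) (last h) \<Longrightarrow> lose m (\<sigma> h)"
    if "last h \<in> t" "Gamma t k (last h) \<noteq> {}" for h m
    using someI_ex[OF ex[OF that]] unfolding \<sigma>_def[symmetric] by auto
  have root: "[] \<in> t" by (simp add: t_def tree_of.root)
  \<comment> \<open>After \<open>i\<close> rounds the current position carries its label with the bound \<open>n - i\<close>.\<close>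
  have inv: "if to_move i = p then win (n - i) (h ! i) else lose (n - i) (h ! i)"
    if h: "history t k [] h" "follows p \<sigma> h" and "i < length h" for h i
    using \<open>i < length h\<close>
  proof (induction i)
    case 0
    have "h ! 0 = []" using h(1) hd_conv_nth[of h] by (auto simp: history_def)
    then show ?case using start
      by (cases p) (auto simp: win_def lose_def to_move_def)
  next
    case (Suc i)
    then have IH: "if to_move i = p then win (n - i) (h ! i) else lose (n - i) (h ! i)" by simp
    have hi: "h ! i \<in> t" using history_mem[OF h(1) root] Suc.prems by simp
    have mv: "h ! Suc i \<in> Gamma t k (h ! i)" using h Suc.prems by (auto simp: history_def)
    \<comment> \<open>The bound has not been used up, because nothing is labelled with bound \<open>0\<close>.\<close>
    have pos: "n - i = Suc (n - Suc i)"
      using IH by (cases "n - i") (auto simp: win_def lose_def split: if_splits)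
    show ?case
    proof (cases "to_move i = p")
      case True
      have eq: "last (take (Suc i) h) = h ! i"
        using Suc.prems by (simp add: take_Suc_conv_app_nth)
      have "h ! Suc i = \<sigma> (take (Suc i) h)"
        using h(2) Suc.prems True by (auto simp: follows_def)
      moreover have "lose (n - Suc i) (\<sigma> (take (Suc i) h))"
        using \<sigma>(2)[of "take (Suc i) h"] eq IH True hi mv pos by auto
      ultimately show ?thesis using True by (simp add: to_move_Suc)
    next
      case False
      then have "lose (Suc (n - Suc i)) (h ! i)" using IH pos by simp
      then show ?thesis using False lose_step[OF hi _ mv] by (simp add: to_move_Suc)
    qed
  qed
  have len: "length h \<le> n" if h: "history t k [] h" "follows p \<sigma> h" for h
  proof (rule ccontr)
    assume "\<not> length h \<le> n"
    then have "n < length h" by simp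
    from inv[OF h this] show False by (auto simp: win_def lose_def split: if_splits)
  qed
  have "is_strategy t k [] p \<sigma>"
    unfolding is_strategy_def
  proof (intro allI impI, elim conjE)
    fix h assume h: "history t k [] h" "Gamma t k (last h) \<noteq> {}"
    then have "h \<noteq> []" by (simp add: history_def)
    then have "last h \<in> t" using history_mem[OF h(1) root] by (simp add: last_conv_nth)
    then show "\<sigma> h \<in> Gamma t k (last h)" using \<sigma>(1) h by blast
  qed
  moreover have "to_move (rounds h) \<noteq> p" if h: "finite_play t k [] h" "follows p \<sigma> h" for h
  proof
    assume p: "to_move (rounds h) = p"
    have hist: "history t k [] h" and G: "Gamma t k (last h) = {}"
      using h by (auto simp: finite_play_def)
    have ne: "h \<noteq> []" using hist by (simp add: history_def)
    then have "win (n - rounds h) (last h)"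
      using inv[OF hist h(2), of "rounds h"] p by (simp add: rounds_def last_conv_nth)
    moreover have "last h \<in> t"
      using history_mem[OF hist root] ne by (simp add: last_conv_nth)
    ultimately show False
      using mover_wins_subtree_iff[of "last h" \<omega> k "n - rounds h - 1"] G
      by (cases "n - rounds h") (auto simp: win_def t_def)
  qed
  moreover have False if f: "infinite_play t k [] f" "\<And>m. follows p \<sigma> (map f [0..<m])" for f
  proof -
    have "history t k [] (map f [0..<Suc n])"
      using f(1) by (auto simp: infinite_play_def history_def hd_map simp del: upt_Suc)
    from len[OF this f(2)] show False by simp
  qed
  moreover have "rounds h < n" if h: "finite_play t k [] h" "follows p \<sigma> h" for h
  proof -
    have "h \<noteq> []" "length h \<le> n" using h len by (auto simp: finite_play_def history_def)
    then show ?thesis by (cases h) (auto simp: rounds_def)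
  qed
  ultimately show ?thesis
    unfolding wins_in_fewer_def winning_strategy_def t_def by blast
qed

text \<open>
  A win of P2 can be enforced within a bounded number of rounds because the tree is locally finite.
  If the root had no bounded loss, P1 could always move to a position without any bounded win for
  the opponent: otherwise all of the finitely many moves would be won for the opponent, and the
  maximum of their bounds would bound the loss. P1 would thus never get stuck, and P2 could not win.
\<close>

lemma winning_strategy_P2_imp_mover_loses:
  assumes w: "winning_strategy (tree_of \<omega>) k [] P2 \<sigma>"
  shows "\<exists>n. mover_loses k n \<omega>"
proof (rule ccontr)
  assume contra: "\<nexists>n. mover_loses k n \<omega>"
  define t where "t = tree_of \<omega>"
  \<comment> \<open>\<open>D\<close> and \<open>E\<close> hold at positions from which the mover has no bounded loss, respectively no bounded win.\<close>
  define D where "D u \<longleftrightarrow> u \<in> t \<and> (\<forall>n. \<not> mover_loses k n (subtree u \<omega>))" for u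
  define E where "E u \<longleftrightarrow> u \<in> t \<and> (\<forall>n. \<not> mover_wins k n (subtree u \<omega>))" for u
  have DE: "\<exists>v\<in>Gamma t k u. E v" if u: "D u" for u
  proof (rule ccontr)
    assume neg: "\<not> (\<exists>v\<in>Gamma t k u. E v)"
    have "\<forall>v\<in>Gamma t k u. \<exists>n. mover_wins k n (subtree v \<omega>)"
      using neg Gamma_subset unfolding E_def by blast
    then obtain N where N: "\<And>v. v \<in> Gamma t k u \<Longrightarrow> mover_wins k (N v) (subtree v \<omega>)"
      by metis
    have fin: "finite (Gamma t k u)" unfolding t_def by (rule finite_Gamma)
    have "mover_wins k (Max (N ` Gamma t k u)) (subtree v \<omega>)" if "v \<in> Gamma t k u" for v
      using N[OF that] by (rule mover_wins_mono[rotated]) (use fin that in auto)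
    then have "mover_loses k (Suc (Max (N ` Gamma t k u))) (subtree u \<omega>)"
      using mover_loses_subtree_iff[of u \<omega>] u by (simp add: D_def t_def)
    with u show False unfolding D_def by blast
  qed
  have ED: "D v" if "E u" "v \<in> Gamma t k u" for u v
  proof -
    have "\<not> mover_loses k n (subtree v \<omega>)" for n
      using that mover_wins_subtree_iff[of u \<omega> k n] unfolding E_def t_def by blast
    moreover have "v \<in> t" using that Gamma_subset by blast
    ultimately show ?thesis by (simp add: D_def)
  qed
  \<comment> \<open>P2 plays the given strategy against a P1 who only moves to positions in \<open>E\<close>.\<close>
  define next_pos where "next_pos h = (if to_move (rounds h) = P1
      then SOME v. v \<in> Gamma t k (last h) \<and> E v else \<sigma> h)" for h
  define hs where "hs n = ((\<lambda>h. h @ [next_pos h]) ^^ n) [[]]" for n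
  define f where "f n = last (hs n)" for n
  have hs_Suc: "hs (Suc n) = hs n @ [next_pos (hs n)]" for n
    by (simp add: hs_def)
  have hs_eq: "hs n = map f [0..<Suc n]" for n
    by (induction n) (simp_all add: hs_Suc f_def, simp add: hs_def)
  have f_Suc: "f (Suc n) = next_pos (hs n)" for n
    by (simp add: f_def hs_Suc)
  have f0: "f 0 = []" by (simp add: f_def hs_def)
  have rounds_hs: "rounds (hs n) = n" for n by (simp add: hs_eq rounds_def)
  have follows_hs: "follows P2 \<sigma> (map f [0..<n])" for n
    unfolding follows_def
  proof (intro allI impI, elim conjE)
    fix i assume i: "Suc i < length (map f [0..<n])" "to_move i = P2"
    then have "take (Suc i) (map f [0..<n]) = hs i"
      by (simp add: hs_eq take_map del: upt_Suc)
    moreover have "f (Suc i) = \<sigma> (hs i)"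
      using i by (simp add: f_Suc next_pos_def rounds_hs)
    ultimately show "map f [0..<n] ! Suc i = \<sigma> (take (Suc i) (map f [0..<n]))"
      using i by simp
  qed
  have strat: "is_strategy t k [] P2 \<sigma>"
    using w by (simp add: winning_strategy_def t_def)
  have hist: "history t k [] (hs n)" if "\<And>i. i < n \<Longrightarrow> f (Suc i) \<in> Gamma t k (f i)" for n
    unfolding hs_eq using that by (auto simp: history_def hd_map f0 simp del: upt_Suc)
  have "(if to_move n = P1 then D (f n) else E (f n)) \<and> f (Suc n) \<in> Gamma t k (f n)" for n
  proof (induction n rule: less_induct)
    case (less n)
    have status: "if to_move n = P1 then D (f n) else E (f n)"
    proof (cases n)
      case 0
      then show ?thesis using contra by (simp add: f0 to_move_def D_def t_def tree_of.root)
    next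
      case (Suc m)
      with less have m: "if to_move m = P1 then D (f m) else E (f m)"
        and step: "f (Suc m) \<in> Gamma t k (f m)" by auto
      show ?thesis
      proof (cases "to_move m = P1")
        case True
        with m DE have "\<exists>v. v \<in> Gamma t k (f m) \<and> E v" by auto
        then have "E (f (Suc m))"
          using someI_ex[of "\<lambda>v. v \<in> Gamma t k (f m) \<and> E v"] True
          by (simp add: f_Suc next_pos_def rounds_hs) (simp add: f_def)
        with True Suc show ?thesis by (simp add: to_move_Suc)
      next
        case False
        with m step ED Suc show ?thesis by (auto simp: to_move_Suc)
      qed
    qed
    have hn: "history t k [] (hs n)" by (rule hist) (use less in auto)
    have lst: "last (hs n) = f n" by (simp add: f_def)
    have "f (Suc n) \<in> Gamma t k (f n)"
    proof (cases "to_move n = P1")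
      case True
      with status DE have "\<exists>v. v \<in> Gamma t k (f n) \<and> E v" by auto
      then show ?thesis
        using someI_ex[of "\<lambda>v. v \<in> Gamma t k (f n) \<and> E v"] True
        by (simp add: f_Suc next_pos_def rounds_hs lst)
    next
      case False
      then have P2: "to_move (rounds (hs n)) = P2" using to_move_cases rounds_hs by metis
      have "Gamma t k (last (hs n)) \<noteq> {}"
      proof
        assume "Gamma t k (last (hs n)) = {}"
        then have "finite_play t k [] (hs n)" using hn by (simp add: finite_play_def)
        then have "to_move (rounds (hs n)) \<noteq> P2"
          using w follows_hs[of "Suc n"] unfolding winning_strategy_def t_def hs_eq by blast
        with P2 show False by simp
      qed
      then have "\<sigma> (hs n) \<in> Gamma t k (last (hs n))"
        using strat hn P2 unfolding is_strategy_def by blast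
      then show ?thesis using False by (simp add: f_Suc next_pos_def rounds_hs lst)
    qed
    with status show ?case by simp
  qed
  then have "infinite_play t k [] f" by (simp add: infinite_play_def f0)
  with w follows_hs show False unfolding winning_strategy_def t_def by blast
qed

lemma P2_wins_iff: 
  "(\<exists>\<sigma>. winning_strategy (tree_of \<omega>) k [] P2 \<sigma>) \<longleftrightarrow> (\<exists>n. mover_loses k n \<omega>)"
proof
  assume "\<exists>n. mover_loses k n \<omega>"
  then obtain n where "mover_loses k n \<omega>" by blast
  then show "\<exists>\<sigma>. winning_strategy (tree_of \<omega>) k [] P2 \<sigma>"
    using labelled_imp_wins_in_fewer[of P2 k n \<omega>] by (auto simp: wins_in_fewer_def)
qed (use winning_strategy_P2_imp_mover_loses in blast)

text \<open>
  The sum counts the bounds with which neither player can enforce a win; these bounds form an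
  initial segment.
\<close>

lemma duration_le:
  "ennreal_of_enat (duration (tree_of \<omega>) k [])
     \<le> (\<Sum>n. indicator {\<omega>. \<not> mover_loses k (Suc n) \<omega> \<and> \<not> mover_wins k (Suc n) \<omega>} \<omega>)"
proof (cases "\<exists>n. mover_loses k (Suc n) \<omega> \<or> mover_wins k (Suc n) \<omega>")
  case True
  define U where "U n = {\<omega>. \<not> mover_loses k (Suc n) \<omega> \<and> \<not> mover_wins k (Suc n) \<omega>}" for n
  define N where "N = (LEAST n. mover_loses k (Suc n) \<omega> \<or> mover_wins k (Suc n) \<omega>)"
  have "mover_loses k (Suc N) \<omega> \<or> mover_wins k (Suc N) \<omega>"
    unfolding N_def using True by (rule LeastI_ex)
  then obtain p \<sigma> where "wins_in_fewer (tree_of \<omega>) k [] p \<sigma> (Suc N)"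
    using labelled_imp_wins_in_fewer[of P1 k "Suc N" \<omega>]
      labelled_imp_wins_in_fewer[of P2 k "Suc N" \<omega>] by auto
  then have "duration (tree_of \<omega>) k [] \<le> enat N"
    unfolding duration_def by (intro Inf_lower) blast
  then have "ennreal_of_enat (duration (tree_of \<omega>) k []) \<le> of_nat N"
    by (metis ennreal_of_enat_enat ennreal_of_enat_le_iff)
  also have "of_nat N = (\<Sum>n<N. indicator (U n) \<omega> :: ennreal)"
  proof -
    have "\<omega> \<in> U n" if "n < N" for n
      using not_less_Least[OF that[unfolded N_def]] by (simp add: U_def)
    then show ?thesis by simp
  qed
  also have "\<dots> \<le> (\<Sum>n. indicator (U n) \<omega>)"
    by (rule sum_le_suminf) auto
  finally show ?thesis unfolding U_def .
next
  case False
  then have "(\<lambda>n. indicator {\<omega>. \<not> mover_loses k (Suc n) \<omega> \<and> \<not> mover_wins k (Suc n) \<omega>} \<omega>) =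
      (\<lambda>n. 1 :: ennreal)"
    by (auto simp: indicator_def)
  then show ?thesis by (simp flip: nn_integral_count_space_nat)
qed

section \<open>Independence of the subtrees of a Galton-Watson tree\<close>

lemma prob_space_GW: "prob_space (GW \<mu>)"
  unfolding GW_def by (intro prob_space_PiM measure_pmf.prob_space_axioms)

lemma space_GW [simp]: "space (GW \<mu>) = UNIV"
  by (simp add: GW_def space_PiM PiE_def)

lemma measurable_GW_component [measurable]: "(\<lambda>\<omega>. \<omega> u) \<in> GW \<mu> \<rightarrow>\<^sub>M count_space UNIV"
proof -
  have "(\<lambda>\<omega>. \<omega> u) \<in> GW \<mu> \<rightarrow>\<^sub>M measure_pmf \<mu>" unfolding GW_def by measurable
  then show ?thesis by (simp cong: measurable_cong_sets)
qed

lemma measurable_subtree [measurable]: "subtree u \<in> GW \<mu> \<rightarrow>\<^sub>M GW \<mu>"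
proof -
  have "(\<lambda>\<omega> w. \<omega> (u @ w)) \<in> GW \<mu> \<rightarrow>\<^sub>M (\<Pi>\<^sub>M u\<in>UNIV. measure_pmf \<mu>)"
  proof (rule measurable_PiM_single')
    show "(\<lambda>\<omega>. \<omega> (u @ w)) \<in> GW \<mu> \<rightarrow>\<^sub>M measure_pmf \<mu>" for w
      using measurable_GW_component by (simp cong: measurable_cong_sets)
  qed simp
  then show ?thesis by (simp add: GW_def subtree_def[abs_def])
qed

lemma pred_all_desc [measurable]:
  assumes [measurable]: "Measurable.pred (GW \<mu>) Q"
  shows "Measurable.pred (GW \<mu>) (all_desc j Q)"
proof (induction j)
  case 0
  show ?case by simp
next
  case (Suc j)
  note [measurable] = Suc
  have "Measurable.pred (GW \<mu>) (\<lambda>\<omega>. \<forall>i. i < \<omega> [] \<longrightarrow>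
      Q (subtree [i] \<omega>) \<and> all_desc j Q (subtree [i] \<omega>))"
    by measurable
  then show ?case by (simp add: all_desc.simps(2)[abs_def])
qed

lemma pred_mover [measurable]:
  "Measurable.pred (GW \<mu>) (mover_loses k n)" "Measurable.pred (GW \<mu>) (mover_wins k n)"
proof -
  have "Measurable.pred (GW \<mu>) (mover_loses k n) \<and> Measurable.pred (GW \<mu>) (mover_wins k n)"
  proof (induction n)
    case 0
    show ?case by (simp add: mover_loses.simps(1)[abs_def] mover_wins.simps(1)[abs_def])
  next
    case (Suc n)
    then have [measurable]: "Measurable.pred (GW \<mu>) (mover_loses k n)"
      "Measurable.pred (GW \<mu>) (mover_wins k n)" by auto
    show ?case unfolding mover_simps[abs_def] by measurable
  qed
  then show "Measurable.pred (GW \<mu>) (mover_loses k n)" "Measurable.pred (GW \<mu>) (mover_wins k n)"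
    by auto
qed

lemma distr_subtree: "distr (GW \<mu>) (GW \<mu>) (subtree u) = GW \<mu>"
proof -
  have "distr (Pi\<^sub>M UNIV (\<lambda>_. measure_pmf \<mu>)) (\<Pi>\<^sub>M i\<in>UNIV. measure_pmf \<mu>)
      (\<lambda>\<omega>. \<lambda>n\<in>UNIV. \<omega> (u @ n)) = (\<Pi>\<^sub>M i\<in>UNIV. measure_pmf \<mu>)"
    by (rule distr_PiM_reindex) (auto simp: measure_pmf.prob_space_axioms inj_on_def)
  then show ?thesis by (simp add: GW_def subtree_def[abs_def] restrict_UNIV)
qed

lemma Collect_in_sets_GW: "Measurable.pred (GW \<mu>) Q \<Longrightarrow> {\<omega>. Q \<omega>} \<in> sets (GW \<mu>)"
  by (drule predE) simp

lemma prob_subtree: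
  assumes [measurable]: "Measurable.pred (GW \<mu>) Q"
  shows "\<P>(\<omega> in GW \<mu>. Q (subtree u \<omega>)) = \<P>(\<omega> in GW \<mu>. Q \<omega>)"
proof -
  have "\<P>(\<omega> in GW \<mu>. Q \<omega>) = \<P>(\<omega> in distr (GW \<mu>) (GW \<mu>) (subtree u). Q \<omega>)"
    by (simp add: distr_subtree)
  also have "\<dots> = \<P>(\<omega> in GW \<mu>. Q (subtree u \<omega>))"
    using Collect_in_sets_GW[OF assms] by (subst measure_distr) (auto simp: vimage_def)
  finally show ?thesis by simp
qed

lemma prob_root: "\<P>(\<omega> in GW \<mu>. \<omega> [] = m) = pmf \<mu> m"
proof -
  have "distr (GW \<mu>) (measure_pmf \<mu>) (\<lambda>\<omega>. \<omega> []) = measure_pmf \<mu>"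
    unfolding GW_def by (rule distr_PiM_component) (auto simp: measure_pmf.prob_space_axioms)
  then have "pmf \<mu> m = measure (distr (GW \<mu>) (measure_pmf \<mu>) (\<lambda>\<omega>. \<omega> [])) {m}"
    by (simp add: measure_pmf_single)
  also have "\<dots> = \<P>(\<omega> in GW \<mu>. \<omega> [] = m)"
    by (subst measure_distr) (auto simp: vimage_def cong: measurable_cong_sets)
  finally show ?thesis by simp
qed

text \<open>
  The branching property. The root label and the labels below the individual children live on
  pairwise disjoint sets of coordinates of the product measure, and are therefore independent.
\<close>

lemma prob_root_and_children:
  assumes Q: "Measurable.pred (GW \<mu>) Q"
  shows "\<P>(\<omega> in GW \<mu>. \<omega> [] = m \<and> (\<forall>i<m. Q (subtree [i] \<omega>))) =
           pmf \<mu> m * \<P>(\<omega> in GW \<mu>. Q \<omega>) ^ m"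
proof -
  note [measurable] = Q
  interpret prob_space "GW \<mu>" by (rule prob_space_GW)
  define M where "M = (\<lambda>_::vertex. measure_pmf \<mu>)"
  \<comment> \<open>Block \<open>None\<close> is the root, and block \<open>Some i\<close> is the set of labels below the \<open>i\<close>-th child.\<close>
  define K where "K j = (case j of None \<Rightarrow> {[]} | Some i \<Rightarrow> range ((#) i))" for j :: "nat option"
  define below where "below i f = (\<lambda>w. f (i # w))" for i :: nat and f :: "vertex \<Rightarrow> nat"
  define Y where "Y j f = (case j of None \<Rightarrow> f [] = m | Some i \<Rightarrow> Q (below i f))" for j f
  have rv: "random_variable (M u) (\<lambda>\<omega>. \<omega> u)" for u
    unfolding M_def GW_def by (rule measurable_component_singleton) simp
  have M_sets: "sets (M u) = sets (count_space UNIV)" for u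
    by (simp add: M_def)
  have ind0: "indep_vars M (\<lambda>u \<omega>. \<omega> u) UNIV"
  proof (subst indep_vars_iff_distr_eq_PiM')
    have "distr (GW \<mu>) (M u) (\<lambda>\<omega>. \<omega> u) = M u" for u
      unfolding GW_def M_def by (rule distr_PiM_component) (auto simp: measure_pmf.prob_space_axioms)
    then have "(\<Pi>\<^sub>M u\<in>UNIV. distr (GW \<mu>) (M u) (\<lambda>\<omega>. \<omega> u)) = Pi\<^sub>M UNIV M"
      by (intro PiM_cong) auto
    moreover have "GW \<mu> = Pi\<^sub>M UNIV M" by (simp add: GW_def M_def)
    ultimately show "distr (GW \<mu>) (Pi\<^sub>M UNIV M) (\<lambda>\<omega>. \<lambda>u\<in>UNIV. \<omega> u) =
        (\<Pi>\<^sub>M u\<in>UNIV. distr (GW \<mu>) (M u) (\<lambda>\<omega>. \<omega> u))"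
      by (simp only: restrict_UNIV distr_id2)
  qed (use rv in simp_all)
  have ind: "indep_vars (\<lambda>j. PiM (K j) M) (\<lambda>j \<omega>. restrict (\<lambda>u. \<omega> u) (K j)) UNIV"
    by (rule indep_vars_restrict[OF ind0]) (auto simp: disjoint_family_on_def K_def split: option.splits)
  have Ym: "Y j \<in> PiM (K j) M \<rightarrow>\<^sub>M count_space UNIV" for j
  proof (cases j)
    case None
    have "(\<lambda>f. f []) \<in> PiM (K j) M \<rightarrow>\<^sub>M M []"
      by (rule measurable_component_singleton) (simp add: K_def None)
    then have "(\<lambda>f. f []) \<in> PiM (K j) M \<rightarrow>\<^sub>M count_space UNIV"
      by (simp add: measurable_cong_sets[OF refl M_sets])
    then show ?thesis unfolding Y_def None by simp
  next
    case (Some i)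
    have "below i \<in> PiM (K j) M \<rightarrow>\<^sub>M GW \<mu>"
      unfolding GW_def below_def
    proof (rule measurable_PiM_single')
      fix w :: vertex
      have "(\<lambda>f. f (i # w)) \<in> PiM (K j) M \<rightarrow>\<^sub>M M (i # w)"
        by (rule measurable_component_singleton) (simp add: K_def Some)
      then show "(\<lambda>f. f (i # w)) \<in> PiM (K j) M \<rightarrow>\<^sub>M measure_pmf \<mu>" by (simp add: M_def)
    qed simp
    then show ?thesis unfolding Y_def Some using Q by (simp add: measurable_compose)
  qed
  have ind2: "indep_vars (\<lambda>_. count_space UNIV) (\<lambda>j \<omega>. Y j (restrict (\<lambda>u. \<omega> u) (K j))) UNIV"
    by (rule indep_vars_compose2[OF ind]) (rule Ym)
  have Y_None: "Y None (restrict (\<lambda>u. \<omega> u) (K None)) \<longleftrightarrow> \<omega> [] = m" for \<omega>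
    by (simp add: Y_def K_def)
  have Y_Some: "Y (Some i) (restrict (\<lambda>u. \<omega> u) (K (Some i))) \<longleftrightarrow> Q (subtree [i] \<omega>)" for \<omega> i
    by (simp add: Y_def K_def below_def subtree_def)
  define L where "L = insert None (Some ` {..<m})"
  have "\<P>(\<omega> in GW \<mu>. \<omega> [] = m \<and> (\<forall>i<m. Q (subtree [i] \<omega>))) =
      prob (\<Inter>j\<in>L. (\<lambda>\<omega>. Y j (restrict (\<lambda>u. \<omega> u) (K j))) -` {True} \<inter> space (GW \<mu>))"
    by (rule arg_cong[where f = prob]) (auto simp: L_def Y_None Y_Some)
  also have "\<dots> = (\<Prod>j\<in>L. prob ((\<lambda>\<omega>. Y j (restrict (\<lambda>u. \<omega> u) (K j))) -` {True} \<inter> space (GW \<mu>)))"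
    by (rule indep_varsD_finite[OF indep_vars_subset[OF ind2]]) (auto simp: L_def)
  also have "\<dots> = prob {\<omega>. \<omega> [] = m} * (\<Prod>i<m. prob {\<omega>. Q (subtree [i] \<omega>)})"
    by (simp add: L_def prod.reindex Y_None Y_Some vimage_def)
  also have "\<dots> = pmf \<mu> m * \<P>(\<omega> in GW \<mu>. Q \<omega>) ^ m"
    using prob_root[of \<mu> m] prob_subtree[OF Q] by simp
  finally show ?thesis .
qed

lemma prob_all_children:
  assumes Q[measurable]: "Measurable.pred (GW \<mu>) Q"
  shows "\<P>(\<omega> in GW \<mu>. \<forall>i<\<omega> []. Q (subtree [i] \<omega>)) = G \<mu> (\<P>(\<omega> in GW \<mu>. Q \<omega>))"
proof -
  interpret prob_space "GW \<mu>" by (rule prob_space_GW)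
  define A where "A m = {\<omega>. \<omega> [] = m \<and> (\<forall>i<m. Q (subtree [i] \<omega>))}" for m
  have [measurable]: "A m \<in> sets (GW \<mu>)" for m
  proof -
    have "{\<omega> \<in> space (GW \<mu>). \<omega> [] = m \<and> (\<forall>i. i < m \<longrightarrow> Q (subtree [i] \<omega>))} \<in> sets (GW \<mu>)"
      by measurable
    then show ?thesis by (simp add: A_def)
  qed
  have "(\<lambda>m. prob (A m)) sums prob (\<Union>m. A m)"
    by (rule finite_measure_UNION) (auto simp: disjoint_family_on_def A_def[abs_def] intro: \<open>A _ \<in> _\<close>[unfolded A_def])
  moreover have "(\<Union>m. A m) = {\<omega>. \<forall>i<\<omega> []. Q (subtree [i] \<omega>)}"
    by (auto simp: A_def)
  moreover have "prob (A m) = pmf \<mu> m * \<P>(\<omega> in GW \<mu>. Q \<omega>) ^ m" for m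
    using prob_root_and_children[OF Q, of m] by (simp add: A_def)
  ultimately show ?thesis by (simp add: G_def sums_iff)
qed

section \<open>Exact recursions for the outcome probabilities\<close>

text \<open>
  The trailing arguments of \<open>g\<close> that stay in place when its recursion is unfolded from
  \<open>g (F 0, \<dots>, F k)\<close>: after each step only the first argument varies.
\<close>

definition F_tail :: "nat pmf \<Rightarrow> nat \<Rightarrow> nat \<Rightarrow> real \<Rightarrow> real list" where
  "F_tail \<mu> k j x = map (\<lambda>i. F \<mu> i x) [k - j..<Suc k]"

lemma F_tail_0: "F_tail \<mu> k 0 x = [F \<mu> k x]"
  by (simp add: F_tail_def)

lemma F_tail_Suc: "j < k \<Longrightarrow> F_tail \<mu> k (Suc j) x = F \<mu> (k - Suc j) x # F_tail \<mu> k j x"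
  by (simp add: F_tail_def upt_conv_Cons Suc_diff_Suc del: upt_Suc)

lemma g_F_tail_Suc:
  assumes "j < k"
  shows "g \<mu> (y # F_tail \<mu> k (Suc j) x) =
    G \<mu> (g \<mu> (y # F_tail \<mu> k j x)) - G \<mu> (g \<mu> (F \<mu> (k - Suc j) x # F_tail \<mu> k j x))"
proof -
  have "\<exists>z zs. F_tail \<mu> k j x = z # zs"
    using assms by (cases j) (simp_all add: F_tail_0 F_tail_Suc)
  then show ?thesis using assms by (auto simp: F_tail_Suc)
qed

lemma H_eq_F_tail: "1 \<le> k \<Longrightarrow> H \<mu> k x = G \<mu> (g \<mu> (F \<mu> 0 x # F_tail \<mu> k (k - 1) x))"
  by (simp add: H_def F_tail_def upt_conv_Cons[of 0] del: upt_Suc)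

text \<open>
  Both recursions below have this shape: each child has to satisfy \<open>Q\<close>, but to avoid a
  subevent \<open>R\<close> of \<open>Q\<close>.
\<close>

lemma prob_all_desc_Suc:
  fixes Q R :: "(vertex \<Rightarrow> nat) \<Rightarrow> bool"
  assumes [measurable]: "Measurable.pred (GW \<mu>) Q" "Measurable.pred (GW \<mu>) R"
  assumes split: "\<And>\<omega>. S \<omega> \<longleftrightarrow> (\<forall>i<\<omega> []. Q (subtree [i] \<omega>) \<and> \<not> R (subtree [i] \<omega>))"
    and sub: "\<And>\<omega>. R \<omega> \<Longrightarrow> Q \<omega>"
  shows "\<P>(\<omega> in GW \<mu>. S \<omega>) = G \<mu> (\<P>(\<omega> in GW \<mu>. Q \<omega>) - \<P>(\<omega> in GW \<mu>. R \<omega>))"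
proof -
  interpret prob_space "GW \<mu>" by (rule prob_space_GW)
  have "\<P>(\<omega> in GW \<mu>. S \<omega>) = G \<mu> (\<P>(\<omega> in GW \<mu>. Q \<omega> \<and> \<not> R \<omega>))"
    unfolding split by (rule prob_all_children) measurable
  also have "\<P>(\<omega> in GW \<mu>. Q \<omega> \<and> \<not> R \<omega>) = prob ({\<omega> \<in> space (GW \<mu>). Q \<omega>} - {\<omega> \<in> space (GW \<mu>). R \<omega>})"
    by (rule arg_cong[where f = prob]) auto
  also have "\<dots> = \<P>(\<omega> in GW \<mu>. Q \<omega>) - \<P>(\<omega> in GW \<mu>. R \<omega>)"
    by (rule finite_measure_Diff) (measurable, use sub in auto)
  finally show ?thesis .
qed

text \<open>
  This explains the functions \<open>F i\<close>. Nothing in the first \<open>i + 1\<close> generations is in \<open>L\<close> iff every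
  child has no descendant in \<open>L\<close> within distance \<open>i\<close> and is not in \<open>L\<close> itself. By hypothesis \<open>L\<close>
  is contained in the first of these events, so the probabilities are simply subtracted.
\<close>

lemma prob_no_loser_within:
  assumes [measurable]: "Measurable.pred (GW \<mu>) L"
    and L: "\<And>\<omega>. L \<omega> \<Longrightarrow> all_desc k (\<lambda>\<omega>. \<not> L \<omega>) \<omega>"
    and "i \<le> Suc k"
  shows "\<P>(\<omega> in GW \<mu>. all_desc i (\<lambda>\<omega>. \<not> L \<omega>) \<omega>) = F \<mu> i (\<P>(\<omega> in GW \<mu>. L \<omega>))"
  using \<open>i \<le> Suc k\<close>
proof (induction i)
  case 0
  interpret prob_space "GW \<mu>" by (rule prob_space_GW)
  show ?case using prob_space by simp
next
  case (Suc i)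
  have "\<P>(\<omega> in GW \<mu>. all_desc (Suc i) (\<lambda>\<omega>. \<not> L \<omega>) \<omega>) =
      G \<mu> (\<P>(\<omega> in GW \<mu>. all_desc i (\<lambda>\<omega>. \<not> L \<omega>) \<omega>) - \<P>(\<omega> in GW \<mu>. L \<omega>))"
    by (rule prob_all_desc_Suc) (use all_desc_mono[OF L] Suc.prems in \<open>auto, measurable\<close>)
  with Suc show ?case by simp
qed

text \<open>
  This explains the functions \<open>g i\<close> and \<open>H k\<close>. Let \<open>B j i\<close> be the probability that the first
  \<open>j\<close> generations lie in \<open>W\<close> and the first \<open>i\<close> avoid \<open>L\<close>. Since \<open>W\<close> is the complement of having
  no member of \<open>L\<close> within distance \<open>k\<close>, splitting at the root gives
  \<open>B (j + 1) (i + 1) = G (B j i - B j k)\<close>. The differences \<open>B j (i + j) - B j k\<close> then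
  obey the recursion that defines \<open>g\<close>, started from \<open>B 0 i = F i\<close>. The index \<open>i + j\<close> covers the
  case of no condition on \<open>L\<close> as well, because \<open>W\<close> is disjoint from \<open>L\<close>.
\<close>

lemma prob_all_winners_within:
  assumes [measurable]: "Measurable.pred (GW \<mu>) L"
    and L: "\<And>\<omega>. L \<omega> \<Longrightarrow> all_desc k (\<lambda>\<omega>. \<not> L \<omega>) \<omega>"
    and k: "1 \<le> k"
  defines "W \<equiv> \<lambda>\<omega>. \<not> all_desc k (\<lambda>\<omega>. \<not> L \<omega>) \<omega>"
  shows "\<P>(\<omega> in GW \<mu>. all_desc k W \<omega>) = H \<mu> k (\<P>(\<omega> in GW \<mu>. L \<omega>))"
proof -
  define x where "x = \<P>(\<omega> in GW \<mu>. L \<omega>)"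
  define B where "B j i = \<P>(\<omega> in GW \<mu>. all_desc j W \<omega> \<and> all_desc i (\<lambda>\<omega>. \<not> L \<omega>) \<omega>)" for j i
  have [measurable]: "Measurable.pred (GW \<mu>) W" unfolding W_def by measurable
  have WL: "W \<omega> \<Longrightarrow> \<not> L \<omega>" for \<omega> using L by (auto simp: W_def)
  have B_Suc: "B (Suc j) (Suc i) = G \<mu> (B j i - B j k)" if "i \<le> k" for i j
    unfolding B_def
  proof (rule prob_all_desc_Suc)
    show "all_desc j W \<omega> \<and> all_desc i (\<lambda>\<omega>. \<not> L \<omega>) \<omega>"
      if "all_desc j W \<omega> \<and> all_desc k (\<lambda>\<omega>. \<not> L \<omega>) \<omega>" for \<omega>
      using that all_desc_mono[of k "\<lambda>\<omega>. \<not> L \<omega>" \<omega> i "\<lambda>\<omega>. \<not> L \<omega>"] \<open>i \<le> k\<close> by simp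
    show "(all_desc (Suc j) W \<omega> \<and> all_desc (Suc i) (\<lambda>\<omega>. \<not> L \<omega>) \<omega>) =
        (\<forall>n<\<omega> []. (all_desc j W (subtree [n] \<omega>) \<and> all_desc i (\<lambda>\<omega>. \<not> L \<omega>) (subtree [n] \<omega>)) \<and>
           \<not> (all_desc j W (subtree [n] \<omega>) \<and> all_desc k (\<lambda>\<omega>. \<not> L \<omega>) (subtree [n] \<omega>)))" for \<omega>
      using WL unfolding all_desc.simps(2) W_def by blast
  qed measurable
  have main: "B j (i + j) - B j k = g \<mu> (F \<mu> i x # F_tail \<mu> k j x)" if "i + j < k" for i j
    using that
  proof (induction j arbitrary: i)
    case 0
    then show ?case
      using prob_no_loser_within[OF assms(1) L, of i] prob_no_loser_within[OF assms(1) L, of k]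
      by (simp add: F_tail_0 B_def x_def)
  next
    case (Suc j)
    then have "g \<mu> (F \<mu> i x # F_tail \<mu> k (Suc j) x) =
        G \<mu> (B j (i + j) - B j k) - G \<mu> (B j (k - 1) - B j k)"
      using Suc.IH[of i] Suc.IH[of "k - Suc j"] by (simp add: g_F_tail_Suc)
    also have "\<dots> = B (Suc j) (i + Suc j) - B (Suc j) k"
      using B_Suc[of "i + j" j] B_Suc[of "k - 1" j] Suc.prems by simp
    finally show ?case by simp
  qed
  have "all_desc k W \<omega> \<Longrightarrow> all_desc k (\<lambda>\<omega>. \<not> L \<omega>) \<omega>" for \<omega>
    using all_desc_mono[of k W \<omega> k "\<lambda>\<omega>. \<not> L \<omega>"] WL by simp
  then have "\<P>(\<omega> in GW \<mu>. all_desc k W \<omega>) = B k k"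
    unfolding B_def by (intro arg_cong[where f = "measure (GW \<mu>)"]) auto
  also have "\<dots> = G \<mu> (B (k - 1) (k - 1) - B (k - 1) k)"
    using B_Suc[of "k - 1" "k - 1"] k by simp
  also have "\<dots> = H \<mu> k x"
    using main[of 0 "k - 1"] k by (simp add: H_eq_F_tail)
  finally show ?thesis by (simp add: x_def)
qed

text \<open>
  A tree is lost with bound \<open>n + 2\<close> iff all moves lead to trees from which some move leads to a
  tree that is lost with bound \<open>n\<close>.
\<close>

lemma prob_mover_loses_step:
  assumes "1 \<le> k"
  shows "\<P>(\<omega> in GW \<mu>. mover_loses k (Suc (Suc n)) \<omega>) = H \<mu> k (\<P>(\<omega> in GW \<mu>. mover_loses k n \<omega>))"
  using prob_all_winners_within[of "mover_loses k n" \<mu> k] assms mover_loses_imp_all_desc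
  by (simp add: mover_simps[abs_def])

lemma prob_mover_wins_step:
  "\<P>(\<omega> in GW \<mu>. mover_wins k (Suc n) \<omega>) = 1 - F \<mu> k (\<P>(\<omega> in GW \<mu>. mover_loses k n \<omega>))"
proof -
  interpret prob_space "GW \<mu>" by (rule prob_space_GW)
  have "\<P>(\<omega> in GW \<mu>. mover_wins k (Suc n) \<omega>) =
      1 - \<P>(\<omega> in GW \<mu>. all_desc k (\<lambda>\<omega>. \<not> mover_loses k n \<omega>) \<omega>)"
    unfolding mover_simps by (rule prob_neg) measurable
  also have "\<P>(\<omega> in GW \<mu>. all_desc k (\<lambda>\<omega>. \<not> mover_loses k n \<omega>) \<omega>) =
      F \<mu> k (\<P>(\<omega> in GW \<mu>. mover_loses k n \<omega>))"
    by (rule prob_no_loser_within) (auto intro: mover_loses_imp_all_desc)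
  finally show ?thesis .
qed

lemma prob_mover_loses_mono:
  "m \<le> n \<Longrightarrow> \<P>(\<omega> in GW \<mu>. mover_loses k m \<omega>) \<le> \<P>(\<omega> in GW \<mu>. mover_loses k n \<omega>)"
proof -
  interpret prob_space "GW \<mu>" by (rule prob_space_GW)
  show "m \<le> n \<Longrightarrow> ?thesis" 
    by (rule finite_measure_mono) (use mover_loses_mono in \<open>auto intro: Collect_in_sets_GW\<close>)
qed

lemma prob_mover_loses_tendsto: "(\<lambda>n. \<P>(\<omega> in GW \<mu>. mover_loses k n \<omega>)) \<longlonglongrightarrow> nl \<mu> k"
proof -
  interpret prob_space "GW \<mu>" by (rule prob_space_GW)
  have "(\<lambda>n. prob {\<omega> \<in> space (GW \<mu>). mover_loses k n \<omega>}) \<longlonglongrightarrow>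
      prob (\<Union>n. {\<omega> \<in> space (GW \<mu>). mover_loses k n \<omega>})"
  proof (rule finite_Lim_measure_incseq)
    show "incseq (\<lambda>n. {\<omega> \<in> space (GW \<mu>). mover_loses k n \<omega>})"
      by (auto simp: incseq_def intro: mover_loses_mono)
  qed (auto simp del: space_GW)
  also have "(\<Union>n. {\<omega> \<in> space (GW \<mu>). mover_loses k n \<omega>}) =
      {\<omega> \<in> space (GW \<mu>). \<exists>\<sigma>. winning_strategy (tree_of \<omega>) k [] P2 \<sigma>}"
    by (auto simp: P2_wins_iff)
  finally show ?thesis by (simp add: nl_def)
qed

lemma expected_duration_le:
  "expected_duration \<mu> k \<le>
    (\<Sum>n. ennreal (F \<mu> k (\<P>(\<omega> in GW \<mu>. mover_loses k n \<omega>)) - \<P>(\<omega> in GW \<mu>. mover_loses k (Suc n) \<omega>)))"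
proof -
  interpret prob_space "GW \<mu>" by (rule prob_space_GW)
  define U where "U n = {\<omega>. \<not> mover_loses k (Suc n) \<omega> \<and> \<not> mover_wins k (Suc n) \<omega>}" for n
  have eq: "U n = space (GW \<mu>) - ({\<omega> \<in> space (GW \<mu>). mover_loses k (Suc n) \<omega>} \<union> {\<omega> \<in> space (GW \<mu>). mover_wins k (Suc n) \<omega>})" for n
    by (auto simp: U_def)
  have U [measurable]: "U n \<in> sets (GW \<mu>)" for n
    unfolding eq by measurable
  have prob_U: "prob (U n) = F \<mu> k (\<P>(\<omega> in GW \<mu>. mover_loses k n \<omega>)) - \<P>(\<omega> in GW \<mu>. mover_loses k (Suc n) \<omega>)" for n
  proof -
    have "prob (U n) = 1 - prob ({\<omega> \<in> space (GW \<mu>). mover_loses k (Suc n) \<omega>} \<union> {\<omega> \<in> space (GW \<mu>). mover_wins k (Suc n) \<omega>})"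
      unfolding eq by (rule prob_compl) measurable
    also have "prob ({\<omega> \<in> space (GW \<mu>). mover_loses k (Suc n) \<omega>} \<union> {\<omega> \<in> space (GW \<mu>). mover_wins k (Suc n) \<omega>})
      = \<P>(\<omega> in GW \<mu>. mover_loses k (Suc n) \<omega>) + \<P>(\<omega> in GW \<mu>. mover_wins k (Suc n) \<omega>)"
      by (rule finite_measure_Union) (measurable, use not_mover_loses_and_wins in blast)
    finally show ?thesis using prob_mover_wins_step[of \<mu> k n] by simp
  qed
  have "expected_duration \<mu> k \<le> (\<integral>\<^sup>+ \<omega>. (\<Sum>n. indicator (U n) \<omega>) \<partial>GW \<mu>)"
    unfolding expected_duration_def U_def by (rule nn_integral_mono) (rule duration_le)
  also have "\<dots> = (\<Sum>n. \<integral>\<^sup>+ \<omega>. indicator (U n) \<omega> \<partial>GW \<mu>)"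
    by (rule nn_integral_suminf) measurable
  also have "\<dots> = (\<Sum>n. ennreal (prob (U n)))"
    by (simp add: emeasure_eq_measure)
  finally show ?thesis by (simp add: prob_U)
qed

section \<open>The generating function and the fixed points\<close>

lemma pmf_sums_1: "pmf \<mu> sums (1::real)" for \<mu> :: "nat pmf"
proof -
  have "(\<lambda>m. measure_pmf.prob \<mu> {m}) sums measure_pmf.prob \<mu> (\<Union>m. {m})"
    by (rule measure_pmf.finite_measure_UNION) (auto simp: disjoint_family_on_def)
  then show ?thesis using measure_pmf.prob_space[of \<mu>] by (simp add: measure_pmf_single)
qed

lemma summable_G:
  assumes "\<bar>x\<bar> \<le> 1"
  shows "summable (\<lambda>m. pmf \<mu> m * x ^ m)"
  by (rule summable_comparison_test'[OF sums_summable[OF pmf_sums_1[of \<mu>]], of 0])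
    (use assms in \<open>auto simp: abs_mult power_abs intro!: mult_left_le power_le_one\<close>)

lemma G_0: "G \<mu> 0 = pmf \<mu> 0"
  unfolding G_def by (rule powser_zero)

lemma G_1: "G \<mu> 1 = 1"
  using pmf_sums_1[of \<mu>] by (simp add: G_def sums_iff)

lemma continuous_on_G: "continuous_on {0..1} (G \<mu>)"
proof -
  have "uniformly_convergent_on {0..1} (\<lambda>n x. \<Sum>m<n. pmf \<mu> m * x ^ m)"
    by (rule Weierstrass_m_test'[OF _ sums_summable[OF pmf_sums_1[of \<mu>]]])
      (auto simp: abs_mult power_abs intro!: mult_left_le power_le_one)
  then have "uniform_limit {0..1} (\<lambda>n x. \<Sum>m<n. pmf \<mu> m * x ^ m) (G \<mu>) sequentially"
    unfolding G_def[abs_def] by (rule uniform_limit_suminf)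
  then show ?thesis
    by (rule uniform_limit_theorem[rotated]) (auto intro!: always_eventually continuous_intros)
qed

lemma G_strict_mono:
  assumes "pmf \<mu> 0 < 1" "0 \<le> x" "x < y" "y \<le> 1"
  shows "G \<mu> x < G \<mu> y"
proof -
  obtain m where m: "0 < m" "pmf \<mu> m > 0"
  proof -
    have "\<exists>m. 0 < m \<and> pmf \<mu> m \<noteq> 0"
    proof (rule ccontr)
      assume none: "\<nexists>m. 0 < m \<and> pmf \<mu> m \<noteq> 0"
      have "pmf \<mu> sums (\<Sum>m\<in>{0}. pmf \<mu> m)"
      proof (rule sums_finite)
        fix m :: nat assume "m \<notin> {0}"
        then have "0 < m" by simp
        with none show "pmf \<mu> m = 0" by blast
      qed simp
      then have "pmf \<mu> 0 = 1" using pmf_sums_1[of \<mu>] sums_unique2 by fastforce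
      with assms(1) show False by simp
    qed
    then obtain m where "0 < m" "pmf \<mu> m \<noteq> 0" by blast
    moreover from this have "0 < pmf \<mu> m" using pmf_nonneg[of \<mu> m] by linarith
    ultimately show ?thesis using that by blast
  qed
  have sm: "summable (\<lambda>m. pmf \<mu> m * y ^ m)" "summable (\<lambda>m. pmf \<mu> m * x ^ m)"
    using assms by (intro summable_G; simp)+
  have "0 < (\<Sum>m. pmf \<mu> m * y ^ m - pmf \<mu> m * x ^ m)"
  proof (rule suminf_pos2)
    show "0 \<le> pmf \<mu> n * y ^ n - pmf \<mu> n * x ^ n" for n
      using assms by (simp add: mult_left_mono power_mono)
    show "0 < pmf \<mu> m * y ^ m - pmf \<mu> m * x ^ m"
      using assms m by (simp add: power_strict_mono)
  qed (intro summable_diff sm)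
  also have "\<dots> = G \<mu> y - G \<mu> x" unfolding G_def by (rule suminf_diff[symmetric, OF sm])
  finally show ?thesis by simp
qed

lemma G_mono:
  assumes "pmf \<mu> 0 < 1" "0 \<le> x" "x \<le> y" "y \<le> 1"
  shows "G \<mu> x \<le> G \<mu> y"
  using G_strict_mono[of \<mu> x y] assms by (cases "x = y") auto

lemma G_has_derivative:
  assumes "\<bar>x\<bar> < 1"
  shows "(G \<mu> has_real_derivative deriv (G \<mu>) x) (at x)"
proof -
  have "summable (\<lambda>n. pmf \<mu> n * 1 ^ n)" by (rule summable_G) simp
  then have "(G \<mu> has_real_derivative (\<Sum>n. diffs (pmf \<mu>) n * x ^ n)) (at x)"
    unfolding G_def[abs_def] by (rule termdiffs_strong) (use assms in simp)
  then show ?thesis by (simp add: DERIV_imp_deriv)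
qed

lemma deriv_G_nonneg:
  assumes "pmf \<mu> 0 < 1" "0 < x" "x < 1"
  shows "0 \<le> deriv (G \<mu>) x"
proof (rule mono_on_imp_deriv_nonneg)
  show "mono_on {0..1} (G \<mu>)" using assms(1) G_mono by (auto simp: mono_on_def)
  show "(G \<mu> has_real_derivative deriv (G \<mu>) x) (at x)" using assms by (intro G_has_derivative) auto
qed (use assms in auto)

text \<open>
  On \<open>{0..fp i}\<close> the argument \<open>F i x - x\<close> decreases strictly from \<open>1\<close> to \<open>0\<close>, so \<open>F (Suc i)\<close>
  decreases strictly from \<open>1\<close> to \<open>pmf \<mu> 0\<close>. As \<open>pmf \<mu> 0 < fp i\<close>, it crosses the diagonal exactly once
  and does so before \<open>fp i\<close>. The bound \<open>pmf \<mu> 0 < fp i\<close> itself has to be carried along the induction.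
\<close>

lemma fp_step:
  assumes \<mu>: "0 < pmf \<mu> 0" "pmf \<mu> 0 < 1"
    and c: "pmf \<mu> 0 < fp \<mu> i" "fp \<mu> i \<le> 1"
    and cont: "continuous_on {0..fp \<mu> i} (F \<mu> i)"
    and anti: "\<And>x y. 0 \<le> x \<Longrightarrow> x \<le> y \<Longrightarrow> y \<le> fp \<mu> i \<Longrightarrow> F \<mu> i y \<le> F \<mu> i x"
    and ends: "F \<mu> i 0 = 1" "F \<mu> i (fp \<mu> i) = fp \<mu> i"
  shows "pmf \<mu> 0 < fp \<mu> (Suc i)" "fp \<mu> (Suc i) < fp \<mu> i"
    and "continuous_on {0..fp \<mu> i} (F \<mu> (Suc i))"
    and "\<And>x y. 0 \<le> x \<Longrightarrow> x \<le> y \<Longrightarrow> y \<le> fp \<mu> i \<Longrightarrow> F \<mu> (Suc i) y \<le> F \<mu> (Suc i) x"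
    and "F \<mu> (Suc i) 0 = 1" "F \<mu> (Suc i) (fp \<mu> (Suc i)) = fp \<mu> (Suc i)"
proof -
  define c where "c = fp \<mu> i"
  note c_props = c[folded c_def] and cont' = cont[folded c_def] and anti' = anti[folded c_def]
    and ends' = ends[folded c_def]
  have range: "F \<mu> i x - x \<in> {0..1}" if "x \<in> {0..c}" for x
    using that anti'[of x c] anti'[of 0 x] ends' by auto
  have cont_Suc: "continuous_on {0..c} (F \<mu> (Suc i))"
    unfolding F.simps
    by (rule continuous_on_compose2[OF continuous_on_G])
      (use range in \<open>auto intro!: continuous_intros cont'\<close>)
  have strict: "F \<mu> (Suc i) y < F \<mu> (Suc i) x" if "0 \<le> x" "x < y" "y \<le> c" for x y
    unfolding F.simps
    by (rule G_strict_mono[OF \<mu>(2)]) (use that range[of x] range[of y] anti'[of x y] in auto)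
  have F0: "F \<mu> (Suc i) 0 = 1" using ends' by (simp add: G_1)
  have Fc: "F \<mu> (Suc i) c = pmf \<mu> 0" using ends' by (simp add: G_0)
  have cpos: "0 < c" using \<mu> c_props by simp
  have "\<exists>x\<ge>0. x \<le> c \<and> x - F \<mu> (Suc i) x = 0"
    by (rule IVT') (use cpos F0 Fc c_props in \<open>auto intro!: continuous_intros cont_Suc simp del: F.simps\<close>)
  then obtain z where z: "z \<in> {0..c}" "F \<mu> (Suc i) z = z" by auto
  have "fp \<mu> (Suc i) = z"
    unfolding fp.simps c_def[symmetric]
  proof (rule the_equality)
    show "z \<in> {0..c} \<and> F \<mu> (Suc i) z = z" using z by blast
    show "x = z" if "x \<in> {0..c} \<and> F \<mu> (Suc i) x = x" for x
      using that z strict[of x z] strict[of z x] by (cases x z rule: linorder_cases) auto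
  qed
  moreover have "z < c" using z Fc c_props by (cases "z = c") auto
  moreover have "pmf \<mu> 0 < z"
    using strict[of z c] z Fc \<open>z < c\<close> by simp
  ultimately show "pmf \<mu> 0 < fp \<mu> (Suc i)" "fp \<mu> (Suc i) < fp \<mu> i"
    "F \<mu> (Suc i) (fp \<mu> (Suc i)) = fp \<mu> (Suc i)"
    using z by (simp_all only: c_def)
  show "continuous_on {0..fp \<mu> i} (F \<mu> (Suc i))" using cont_Suc by (simp only: c_def)
  show "F \<mu> (Suc i) 0 = 1" by (fact F0)
  show "F \<mu> (Suc i) y \<le> F \<mu> (Suc i) x" if "0 \<le> x" "x \<le> y" "y \<le> fp \<mu> i" for x y
    using strict[of x y] that by (cases "x = y") (auto simp: c_def)
qed

lemma fp_props:
  assumes \<mu>: "0 < pmf \<mu> 0" "pmf \<mu> 0 < 1"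
  shows "pmf \<mu> 0 < fp \<mu> i" "fp \<mu> i \<le> 1"
    and "continuous_on {0..fp \<mu> i} (F \<mu> i)"
    and "\<And>x y. 0 \<le> x \<Longrightarrow> x \<le> y \<Longrightarrow> y \<le> fp \<mu> i \<Longrightarrow> F \<mu> i y \<le> F \<mu> i x"
    and "F \<mu> i 0 = 1" "F \<mu> i (fp \<mu> i) = fp \<mu> i"
proof (induction i)
  case 0
  { case 1 show ?case using \<mu> by simp next case 2 show ?case by simp
  next case 3 show ?case by simp next case 4 show ?case by simp
  next case 5 show ?case by simp next case 6 show ?case by simp }
next
  case (Suc i)
  note s = fp_step[OF \<mu> Suc]
  { case 1 show ?case by (rule s) next case 2 show ?case using s(2) Suc(2) by simp
  next case 3 show ?case using s(2) by (intro continuous_on_subset[OF s(3)]) auto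
  next case 4 then show ?case using s(2) by (intro s(4)) auto
  next case 5 show ?case by (rule s) next case 6 show ?case by (rule s) }
qed

lemma fp_strict_decreasing:
  assumes \<mu>: "0 < pmf \<mu> 0" "pmf \<mu> 0 < 1" and "m < k"
  shows "fp \<mu> k < fp \<mu> m"
  using \<open>m < k\<close>
proof (induction rule: strict_inc_induct)
  case (base i)
  then show ?case using fp_step(2)[OF \<mu> fp_props[OF \<mu>]] by simp
next
  case (step i)
  then show ?case using fp_step(2)[OF \<mu> fp_props[OF \<mu>], of i] by simp
qed

text \<open>
  At \<open>fp k\<close> every argument at which \<open>G\<close> is evaluated, in \<open>F k\<close> and by \<open>g_at_fp\<close> also in \<open>H k\<close>, has
  this form, hence lies inside the disc of convergence. This is what makes \<open>F k\<close> and \<open>H k\<close> differentiable there, even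
  if the mean of \<open>\<mu>\<close> is infinite.
\<close>

lemma F_minus_fp_bounds:
  assumes \<mu>: "0 < pmf \<mu> 0" "pmf \<mu> 0 < 1" and "m < k"
  shows "0 < F \<mu> m (fp \<mu> k) - fp \<mu> k" "F \<mu> m (fp \<mu> k) - fp \<mu> k < 1"
proof -
  note p = fp_props[OF \<mu>]
  have less: "fp \<mu> k < fp \<mu> m" by (rule fp_strict_decreasing[OF \<mu> \<open>m < k\<close>])
  have pos: "0 < fp \<mu> k" using p(1)[of k] \<mu> by simp
  show "0 < F \<mu> m (fp \<mu> k) - fp \<mu> k"
    using p(4)[where i = m and x = "fp \<mu> k" and y = "fp \<mu> m"] p(6)[of m] less pos by auto
  show "F \<mu> m (fp \<mu> k) - fp \<mu> k < 1"
    using p(4)[where i = m and x = 0 and y = "fp \<mu> k"] p(5)[of m] less pos by auto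
qed

section \<open>Derivatives at the fixed points\<close>

text \<open>
  The slopes below are the derivatives at \<open>fp k\<close> of \<open>G\<close>, \<open>F m\<close> and \<open>g\<close>, expressed through the
  nonnegative numbers \<open>G_slope \<mu> k m\<close> by the chain rule.
\<close>

definition G_slope :: "nat pmf \<Rightarrow> nat \<Rightarrow> nat \<Rightarrow> real" where
  "G_slope \<mu> k m = deriv (G \<mu>) (F \<mu> m (fp \<mu> k) - fp \<mu> k)"

lemma G_has_derivative_at_fp:
  assumes "0 < pmf \<mu> 0" "pmf \<mu> 0 < 1" and "m < k"
  shows "(G \<mu> has_real_derivative G_slope \<mu> k m) (at (F \<mu> m (fp \<mu> k) - fp \<mu> k))"
  unfolding G_slope_def using F_minus_fp_bounds[OF assms] by (intro G_has_derivative) auto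

lemma G_slope_nonneg:
  assumes "0 < pmf \<mu> 0" "pmf \<mu> 0 < 1" and "m < k"
  shows "0 \<le> G_slope \<mu> k m"
  unfolding G_slope_def using F_minus_fp_bounds[OF assms] assms by (intro deriv_G_nonneg) auto

primrec F_slope :: "nat pmf \<Rightarrow> nat \<Rightarrow> nat \<Rightarrow> real" where
  "F_slope \<mu> k 0 = 0"
| "F_slope \<mu> k (Suc m) = G_slope \<mu> k m * (F_slope \<mu> k m - 1)"

lemma F_has_derivative_at_fp:
  assumes \<mu>: "0 < pmf \<mu> 0" "pmf \<mu> 0 < 1" and "m \<le> k"
  shows "(F \<mu> m has_real_derivative F_slope \<mu> k m) (at (fp \<mu> k))"
  using \<open>m \<le> k\<close>
proof (induction m)
  case 0
  have "F \<mu> 0 = (\<lambda>_. 1)" by auto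
  then show ?case by simp
next
  case (Suc m)
  then have "((\<lambda>x. F \<mu> m x - x) has_real_derivative F_slope \<mu> k m - 1) (at (fp \<mu> k))"
    by (intro derivative_intros) auto
  from DERIV_chain2[OF G_has_derivative_at_fp[OF \<mu>] this] Suc.prems
  show ?case by simp
qed

primrec g_slope :: "nat pmf \<Rightarrow> nat \<Rightarrow> nat \<Rightarrow> nat \<Rightarrow> real" where
  "g_slope \<mu> k 0 i = F_slope \<mu> k i - F_slope \<mu> k k"
| "g_slope \<mu> k (Suc j) i =
     G_slope \<mu> k (i + j) * g_slope \<mu> k j i - G_slope \<mu> k (k - 1) * g_slope \<mu> k j (k - Suc j)"

text \<open>
  At \<open>c = fp k\<close> the recursion of \<open>g\<close> collapses: if the formula holds for \<open>j\<close>, then its first term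
  for \<open>j + 1\<close> is \<open>G (F (i + j) - c) = F (i + j + 1)\<close>, and the subtracted one is
  \<open>G (F (k - 1) - c) = F k = c\<close>.
\<close>

lemma g_at_fp:
  assumes \<mu>: "0 < pmf \<mu> 0" "pmf \<mu> 0 < 1" and "i + j < k"
  shows "g \<mu> (F \<mu> i (fp \<mu> k) # F_tail \<mu> k j (fp \<mu> k)) = F \<mu> (i + j) (fp \<mu> k) - fp \<mu> k"
    and "((\<lambda>x. g \<mu> (F \<mu> i x # F_tail \<mu> k j x)) has_real_derivative g_slope \<mu> k j i) (at (fp \<mu> k))"
  using \<open>i + j < k\<close>
proof (induction j arbitrary: i)
  case 0
  { case 1
    show ?case using fp_props(6)[OF \<mu>, of k] by (simp add: F_tail_0)
  next
    case 2
    then show ?case using F_has_derivative_at_fp[OF \<mu>, of _ k]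
      by (auto simp: F_tail_0 intro!: derivative_intros) }
next
  case (Suc j)
  { case 1
    have "F \<mu> k (fp \<mu> k) = G \<mu> (F \<mu> (k - 1) (fp \<mu> k) - fp \<mu> k)"
      using 1 F.simps(2)[of \<mu> "k - 1" "fp \<mu> k"] by simp
    then show ?case
      using 1 Suc.IH(1)[of i] Suc.IH(1)[of "k - Suc j"] fp_props(6)[OF \<mu>, of k]
      by (simp add: g_F_tail_Suc)
  next
    case 2
    have "((\<lambda>x. G \<mu> (g \<mu> (F \<mu> i x # F_tail \<mu> k j x))) has_real_derivative
        G_slope \<mu> k (i + j) * g_slope \<mu> k j i) (at (fp \<mu> k))"
      by (rule DERIV_chain2) (use 2 Suc.IH[of i] G_has_derivative_at_fp[OF \<mu>, of "i + j" k] in auto)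
    moreover have "((\<lambda>x. G \<mu> (g \<mu> (F \<mu> (k - Suc j) x # F_tail \<mu> k j x))) has_real_derivative
        G_slope \<mu> k (k - 1) * g_slope \<mu> k j (k - Suc j)) (at (fp \<mu> k))"
      by (rule DERIV_chain2)
        (use 2 Suc.IH[of "k - Suc j"] G_has_derivative_at_fp[OF \<mu>, of "k - 1" k] in auto)
    ultimately show ?case
      using 2 by (simp add: g_F_tail_Suc DERIV_diff) }
qed

lemma H_fp:
  assumes \<mu>: "0 < pmf \<mu> 0" "pmf \<mu> 0 < 1" and k: "1 \<le> k"
  shows "H \<mu> k (fp \<mu> k) = fp \<mu> k"
    and "(H \<mu> k has_real_derivative G_slope \<mu> k (k - 1) * g_slope \<mu> k (k - 1) 0) (at (fp \<mu> k))"
proof -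
  note at_fp = g_at_fp[OF \<mu>, of 0 "k - 1" k]
  have "H \<mu> k (fp \<mu> k) = G \<mu> (F \<mu> (k - 1) (fp \<mu> k) - fp \<mu> k)"
    using at_fp(1) k by (simp add: H_eq_F_tail)
  also have "\<dots> = F \<mu> k (fp \<mu> k)"
    using F.simps(2)[of \<mu> "k - 1" "fp \<mu> k"] k by simp
  finally show "H \<mu> k (fp \<mu> k) = fp \<mu> k" using fp_props(6)[OF \<mu>] by simp
  have "H \<mu> k = (\<lambda>x. G \<mu> (g \<mu> (F \<mu> 0 x # F_tail \<mu> k (k - 1) x)))"
    using k H_eq_F_tail by blast
  moreover have "((\<lambda>x. G \<mu> (g \<mu> (F \<mu> 0 x # F_tail \<mu> k (k - 1) x))) has_real_derivative
      G_slope \<mu> k (k - 1) * g_slope \<mu> k (k - 1) 0) (at (fp \<mu> k))"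
    by (rule DERIV_chain2) (use k at_fp G_has_derivative_at_fp[OF \<mu>, of "k - 1" k] in auto)
  ultimately show "(H \<mu> k has_real_derivative G_slope \<mu> k (k - 1) * g_slope \<mu> k (k - 1) 0) (at (fp \<mu> k))"
    by simp
qed

text \<open>
  With \<open>s\<close> the absolute value of the derivative of \<open>F 2\<close>, the derivative of \<open>H 2\<close> is \<open>s\<^sup>2\<close> minus a
  nonnegative quantity.
\<close>

lemma deriv_H_less_1_k2:
  assumes \<mu>: "0 < pmf \<mu> 0" "pmf \<mu> 0 < 1" and "\<bar>deriv (F \<mu> 2) (fp \<mu> 2)\<bar> < 1"
  shows "deriv (H \<mu> 2) (fp \<mu> 2) < 1"
proof -
  define a b where "a = G_slope \<mu> 2 0" and "b = G_slope \<mu> 2 1"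
  define s where "s = b * (1 + a)"
  have nn: "0 \<le> a" "0 \<le> b" unfolding a_def b_def using G_slope_nonneg[OF \<mu>] by simp_all
  then have s0: "0 \<le> s" by (simp add: s_def)
  have "deriv (F \<mu> 2) (fp \<mu> 2) = F_slope \<mu> 2 2"
    using F_has_derivative_at_fp[OF \<mu>, of 2 2] by (simp add: DERIV_imp_deriv)
  also have "F_slope \<mu> 2 2 = - s"
    by (simp add: numeral_2_eq_2 s_def a_def b_def algebra_simps)
  finally have s1: "s < 1" using assms by simp
  have "deriv (H \<mu> 2) (fp \<mu> 2) = G_slope \<mu> 2 1 * g_slope \<mu> 2 1 0"
    using H_fp(2)[OF \<mu>, of 2] by (simp add: DERIV_imp_deriv)
  also have "\<dots> = b * (a * s - b * (s - a))"
    using \<open>F_slope \<mu> 2 2 = - s\<close> by (simp add: a_def b_def algebra_simps)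
  also have "\<dots> = s\<^sup>2 - b\<^sup>2 * (1 + s)"
    unfolding s_def by algebra
  also have "\<dots> \<le> s\<^sup>2" using s0 by simp
  also have "\<dots> < 1" using s0 s1 by (simp add: power_less_one_iff)
  finally show ?thesis .
qed

text \<open>
  Again the derivative of \<open>H 3\<close> is at most the square of the derivative of \<open>F 3\<close>. Here the sign of
  the correction depends on \<open>d \<le> 1\<close>, which follows from \<open>d \<le> s < 1\<close>.
\<close>

lemma deriv_H_less_1_k3:
  assumes \<mu>: "0 < pmf \<mu> 0" "pmf \<mu> 0 < 1" and "\<bar>deriv (F \<mu> 3) (fp \<mu> 3)\<bar> < 1"
  shows "deriv (H \<mu> 3) (fp \<mu> 3) < 1"
proof -
  define a b d where "a = G_slope \<mu> 3 0" and "b = G_slope \<mu> 3 1" and "d = G_slope \<mu> 3 2"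
  define t where "t = b * (1 + a)"
  define s where "s = d * (1 + t)"
  have nn: "0 \<le> a" "0 \<le> b" "0 \<le> d"
    unfolding a_def b_def d_def using G_slope_nonneg[OF \<mu>] by simp_all
  then have t0: "0 \<le> t" and ds: "d \<le> s" by (simp_all add: t_def s_def algebra_simps)
  have F: "F_slope \<mu> 3 (Suc 0) = - a" "F_slope \<mu> 3 2 = - t" "F_slope \<mu> 3 3 = - s"
    by (simp_all add: numeral_2_eq_2 numeral_3_eq_3 s_def t_def a_def b_def d_def algebra_simps)
  have "deriv (F \<mu> 3) (fp \<mu> 3) = F_slope \<mu> 3 3"
    using F_has_derivative_at_fp[OF \<mu>, of 3 3] by (simp add: DERIV_imp_deriv)
  then have s1: "s < 1" using F assms by simp
  have s0: "0 \<le> s" using nn ds by simp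
  have "deriv (H \<mu> 3) (fp \<mu> 3) = G_slope \<mu> 3 2 * g_slope \<mu> 3 2 0"
    using H_fp(2)[OF \<mu>, of 3] by (simp add: DERIV_imp_deriv)
  also have "g_slope \<mu> 3 2 0 = b * (a * s - d * (s - t)) - d * (b * (s - a) - d * (s - t))"
    using F by (simp add: eval_nat_numeral(2) a_def b_def d_def)
  also have "G_slope \<mu> 3 2 * \<dots> = s\<^sup>2 - (1 + s) * d\<^sup>2 * (1 - d) - 2 * b * d\<^sup>2 * (1 + s)"
    unfolding d_def[symmetric] s_def t_def by algebra
  also have "\<dots> \<le> s\<^sup>2" 
  proof -
    have "0 \<le> (1 + s) * d\<^sup>2 * (1 - d)" "0 \<le> 2 * b * d\<^sup>2 * (1 + s)"
      using s0 s1 ds nn by simp_all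
    then show ?thesis by linarith
  qed
  also have "\<dots> < 1" using s0 s1 by (simp add: power_less_one_iff)
  finally show ?thesis .
qed

section \<open>Summability of the tail probabilities\<close>

text \<open>
  Summing the inequality bounds each partial sum by two initial terms plus \<open>\<rho>\<close> times itself.
\<close>

lemma summable_if_two_step_contraction:
  fixes d :: "nat \<Rightarrow> real"
  assumes nonneg: "\<And>n. 0 \<le> d n" and \<rho>: "0 \<le> \<rho>" "\<rho> < 1"
    and step: "\<And>n. N \<le> n \<Longrightarrow> d (n + 2) \<le> \<rho> * d n"
  shows "summable d"
proof -
  define a where "a n = d (n + N)" for n
  have a: "0 \<le> a n" "a (n + 2) \<le> \<rho> * a n" for n
    using nonneg step[of "n + N"] by (simp_all add: a_def add_ac)
  have "sum a {..<n} \<le> (a 0 + a 1) / (1 - \<rho>)" for n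
  proof -
    have "sum a {..<n} \<le> sum a {..<n + 2}"
      by (rule sum_mono2) (use a in auto)
    also have "sum a {..<n + 2} = a 0 + a 1 + (\<Sum>i<n. a (i + 2))"
      by (simp add: numeral_2_eq_2 sum.lessThan_Suc_shift del: sum.lessThan_Suc)
    also have "\<dots> \<le> a 0 + a 1 + (\<Sum>i<n. \<rho> * a i)"
      by (intro add_left_mono sum_mono a)
    finally have "sum a {..<n} \<le> a 0 + a 1 + \<rho> * sum a {..<n}"
      by (simp add: sum_distrib_left)
    then have "(1 - \<rho>) * sum a {..<n} \<le> a 0 + a 1" by (simp add: algebra_simps)
    with \<rho> show ?thesis by (simp add: field_simps)
  qed
  then have "summable a" by (rule summableI_nonneg_bounded[OF a(1)])
  then show ?thesis unfolding a_def by (simp add: summable_iff_shift)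
qed

text \<open>
  The probabilities \<open>x n\<close> of a loss with bound \<open>n\<close> increase to the fixed point \<open>c\<close> of \<open>H k\<close> and are
  iterated by \<open>H k\<close> in steps of two, so the distance to \<open>c\<close> contracts. The probability that the
  game is still undecided after \<open>n\<close> rounds is \<open>F k (x n) - x (n + 1)\<close>. As \<open>F k\<close> fixes \<open>c\<close> and is
  differentiable there, this is at most linear in the distances of \<open>x n\<close> and \<open>x (n + 1)\<close> to \<open>c\<close>.
\<close>

lemma finite_expected_duration:
  assumes \<mu>: "0 < pmf \<mu> 0" "pmf \<mu> 0 < 1" and k: "1 \<le> k"
    and nl: "nl \<mu> k = fp \<mu> k" and H: "deriv (H \<mu> k) (fp \<mu> k) < 1"
  shows "expected_duration \<mu> k < \<infinity>"
proof -
  define c where "c = fp \<mu> k"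
  define x where "x n = \<P>(\<omega> in GW \<mu>. mover_loses k n \<omega>)" for n
  define d where "d n = c - x n" for n
  have lim: "x \<longlonglongrightarrow> c"
    using prob_mover_loses_tendsto[of \<mu> k] nl by (simp add: x_def[abs_def] c_def)
  have "incseq x" unfolding incseq_def x_def by (blast intro: prob_mover_loses_mono)
  then have d_nonneg: "0 \<le> d n" for n
    using incseq_le[OF _ lim] by (simp add: d_def)
  have x_step: "x (n + 2) = H \<mu> k (x n)" for n
    using prob_mover_loses_step[OF k, of \<mu> n] by (simp add: x_def)
  have Hc: "H \<mu> k c = c" unfolding c_def by (rule H_fp[OF \<mu> k])
  have Fc: "F \<mu> k c = c" unfolding c_def by (rule fp_props(6)[OF \<mu>])
  obtain \<rho> where \<rho>: "0 \<le> \<rho>" "\<rho> < 1" "deriv (H \<mu> k) c < \<rho>"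
    using dense[of "max 0 (deriv (H \<mu> k) c)" 1] H by (auto simp: c_def intro: less_imp_le)
  have "(H \<mu> k has_real_derivative deriv (H \<mu> k) c) (at c)"
    using H_fp(2)[OF \<mu> k] by (simp add: c_def DERIV_imp_deriv)
  then have "eventually (\<lambda>y. (H \<mu> k y - c) / (y - c) < \<rho>) (at c)"
    using order_tendstoD(2)[OF _ \<rho>(3)] by (simp add: has_field_derivative_iff Hc)
  then have "eventually (\<lambda>y. y \<noteq> c \<longrightarrow> (H \<mu> k y - c) / (y - c) < \<rho>) (nhds c)"
    by (simp add: eventually_at_filter)
  then have "eventually (\<lambda>n. x n \<noteq> c \<longrightarrow> (H \<mu> k (x n) - c) / (x n - c) < \<rho>) sequentially"
    by (rule eventually_compose_filterlim[OF _ lim])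
  then obtain N where N: "\<And>n. N \<le> n \<Longrightarrow> x n \<noteq> c \<Longrightarrow> (H \<mu> k (x n) - c) / (x n - c) < \<rho>"
    by (auto simp: eventually_sequentially)
  have contraction: "d (n + 2) \<le> \<rho> * d n" if "N \<le> n" for n
  proof (cases "x n = c")
    case True
    then show ?thesis using x_step[of n] by (simp add: d_def Hc)
  next
    case False
    then have "x n < c" using d_nonneg[of n] by (simp add: d_def)
    then show ?thesis using N[OF that False] x_step[of n] by (simp add: d_def field_simps)
  qed
  have d_sum: "summable d"
    using d_nonneg \<rho>(1,2) contraction by (rule summable_if_two_step_contraction[of d])
  define K where "K = \<bar>F_slope \<mu> k k\<bar> + 1"
  have "((\<lambda>y. \<bar>(F \<mu> k y - c) / (y - c)\<bar>) \<longlongrightarrow> \<bar>F_slope \<mu> k k\<bar>) (at c)"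
    using F_has_derivative_at_fp[OF \<mu> order_refl, of k] Fc
    by (intro tendsto_rabs) (simp add: has_field_derivative_iff c_def)
  then have "eventually (\<lambda>y. \<bar>(F \<mu> k y - c) / (y - c)\<bar> < K) (at c)"
    by (rule order_tendstoD) (simp add: K_def)
  then have "eventually (\<lambda>y. y \<noteq> c \<longrightarrow> \<bar>(F \<mu> k y - c) / (y - c)\<bar> < K) (nhds c)"
    by (simp add: eventually_at_filter)
  then have "eventually (\<lambda>n. x n \<noteq> c \<longrightarrow> \<bar>(F \<mu> k (x n) - c) / (x n - c)\<bar> < K) sequentially"
    by (rule eventually_compose_filterlim[OF _ lim])
  then have F_le: "eventually (\<lambda>n. \<bar>F \<mu> k (x n) - c\<bar> \<le> K * d n) sequentially"
  proof eventually_elim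
    case (elim n)
    show ?case
    proof (cases "x n = c")
      case True
      then show ?thesis by (simp add: Fc d_def)
    next
      case False
      then have "x n < c" using d_nonneg[of n] by (simp add: d_def)
      then show ?thesis using elim by (simp add: d_def abs_divide field_simps)
    qed
  qed
  define t where "t n = F \<mu> k (x n) - x (Suc n)" for n
  have "summable (\<lambda>n. K * d n + d (Suc n))"
    using d_sum by (intro summable_add summable_mult) (auto simp: summable_Suc_iff)
  moreover have "eventually (\<lambda>n. norm \<bar>t n\<bar> \<le> K * d n + d (Suc n)) sequentially"
    using F_le
  proof eventually_elim
    case (elim n)
    have "t n = (F \<mu> k (x n) - c) + d (Suc n)" by (simp add: t_def d_def)
    with elim d_nonneg[of "Suc n"] show ?case by simp
  qed
  ultimately have t_sum: "summable (\<lambda>n. \<bar>t n\<bar>)"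
    by (rule summable_comparison_test_ev[rotated])
  have "expected_duration \<mu> k \<le> (\<Sum>n. ennreal (t n))"
    using expected_duration_le[of \<mu> k] by (simp add: t_def x_def)
  also have "\<dots> \<le> (\<Sum>n. ennreal \<bar>t n\<bar>)"
    by (intro suminf_le) (auto intro: ennreal_leI)
  also have "\<dots> = ennreal (\<Sum>n. \<bar>t n\<bar>)"
    by (rule suminf_ennreal2) (use t_sum in auto)
  finally show ?thesis by (simp add: order_le_less_trans)
qed

theorem theorem1p10:
  fixes \<mu> :: "nat pmf"
  assumes "0 < pmf \<mu> 0" and "pmf \<mu> 0 < 1"
  shows "(\<forall>k\<ge>1. nl \<mu> k = fp \<mu> k \<and>
              max (deriv (H \<mu> k) (fp \<mu> k)) \<bar>deriv (F \<mu> k) (fp \<mu> k)\<bar> < 1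
            \<longrightarrow> expected_duration \<mu> k < \<infinity>)
       \<and> (\<forall>k\<in>{2, 3}. nl \<mu> k = fp \<mu> k \<and> \<bar>deriv (F \<mu> k) (fp \<mu> k)\<bar> < 1
            \<longrightarrow> expected_duration \<mu> k < \<infinity>)"
proof (intro conjI allI ballI impI)
  fix k :: nat
  assume "1 \<le> k" "nl \<mu> k = fp \<mu> k \<and> max (deriv (H \<mu> k) (fp \<mu> k)) \<bar>deriv (F \<mu> k) (fp \<mu> k)\<bar> < 1"
  then show "expected_duration \<mu> k < \<infinity>"
    by (intro finite_expected_duration[OF assms]) auto
next
  fix k :: nat
  assume k: "k \<in> {2, 3}" and *: "nl \<mu> k = fp \<mu> k \<and> \<bar>deriv (F \<mu> k) (fp \<mu> k)\<bar> < 1"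
  then have "deriv (H \<mu> k) (fp \<mu> k) < 1"
    using deriv_H_less_1_k2[OF assms] deriv_H_less_1_k3[OF assms] by auto
  with k * show "expected_duration \<mu> k < \<infinity>"
    by (intro finite_expected_duration[OF assms]) auto
qed

end
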